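(* Let $G$ be a compact connected abelian group. Then the following conditions (i), (ii) and (iii) on a linear form $L:L^2(G)\to\mathbb{C}$ (not assumed continuous) are equivalent. (i) $L$ is translation invariant; that is, $L(\delta_g\ast f)=L(f)$ for all $g\in G$ and $f\in L^2(G)$. (ii) There is $n\in\mathbb{Z}$ with $n\notin\{-1,1\}$ such that $$L\bigl((\delta_g+\delta_{g^{-1}})\ast f\bigr)=L\bigl((\delta_{g^n}+\delta_{g^{-n}})\ast f\bigr)$$ for all $g\in G$ and $f\in L^2(G)$. (iii) $L$ is a multiple of the Haar measure; that is, there is $c\in\mathbb{C}$ with $L(f)=c\int_Gf\,d\mu_G$ for all $f\in L^2(G)$. Also, the normalised Haar measure $\mu_G$ on $G$ is unique.
   Context: The group operation is written multiplicatively, $\mu_G$ denotes the normalised Haar measure on $G$, and $L^2(G)=L^2(G,\mu_G)$ (complex-valued functions). $\delta_g$ is the Dirac measure at $g\in G$ and $\ast$ is convolution on $G$, so $(\delta_g\ast f)(x)=f(g^{-1}x)$. *)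

theory Defs
  imports "HOL-Probability.Probability"
begin

(* A compact abelian group is a type of class {topological_ab_group_add, t2_space} with
   compact UNIV.  These classes are additive: g + h, - g and int_multiple n g below are
   the product gh, the inverse and the power g^n of multiplicative notation. *)

definition int_multiple :: "int \<Rightarrow> 'a::ab_group_add \<Rightarrow> 'a" where
  "int_multiple n g = (if n \<ge> 0 then (\<Sum>i<nat n. g) else - (\<Sum>i<nat (- n). g))"

(* Regularity has to be required separately: a finite Borel measure on a compact
   Hausdorff space that is not metrizable need not be regular. *)

definition normalised_haar :: "'a::{topological_ab_group_add, t2_space} measure \<Rightarrow> bool" where
  "normalised_haar M \<longleftrightarrow>
     sets M = sets borel \<and>
     prob_space M \<and>
     (\<forall>A\<in>sets borel. emeasure M A = (SUP K\<in>{K. K \<subseteq> A \<and> compact K}. emeasure M K)) \<and>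
     (\<forall>A\<in>sets borel. emeasure M A = (INF U\<in>{U. A \<subseteq> U \<and> open U}. emeasure M U)) \<and>
     (\<forall>g. \<forall>A\<in>sets borel. emeasure M ((\<lambda>x. g + x) ` A) = emeasure M A)"

definition square_integrable :: "'a measure \<Rightarrow> ('a \<Rightarrow> complex) set" where
  "square_integrable M =
     {f \<in> borel_measurable M. integrable M (\<lambda>x. (cmod (f x))\<^sup>2)}"

(* The space L^2(M) consists of the classes L2_class M f with f in square_integrable M,
   with the vector space operations of representatives. *)

definition L2_class :: "'a measure \<Rightarrow> ('a \<Rightarrow> complex) \<Rightarrow> ('a \<Rightarrow> complex) set" where
  "L2_class M f = {h \<in> square_integrable M. AE x in M. h x = f x}"

(* HOL functions are total; only the values of a linear form on classes of
   square-integrable functions are relevant. *)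

definition L2_linear_form :: "'a measure \<Rightarrow> (('a \<Rightarrow> complex) set \<Rightarrow> complex) \<Rightarrow> bool" where
  "L2_linear_form M L \<longleftrightarrow>
     (\<forall>f\<in>square_integrable M. \<forall>h\<in>square_integrable M.
        L (L2_class M (\<lambda>x. f x + h x)) = L (L2_class M f) + L (L2_class M h)) \<and>
     (\<forall>c. \<forall>f\<in>square_integrable M.
        L (L2_class M (\<lambda>x. c * f x)) = c * L (L2_class M f))"

(* The convolution of a measure nu with f at x is the integral of f (- y + x) with
   respect to nu(dy); for the Dirac measure at g this is f (- g + x). *)

definition dirac_conv :: "'a::ab_group_add \<Rightarrow> ('a \<Rightarrow> complex) \<Rightarrow> 'a \<Rightarrow> complex" where
  "dirac_conv g f = (\<lambda>x. f (- g + x))"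

end

theory Submission
  imports Defs "HOL-Computational_Algebra.Polynomial"
begin

text \<open>
  Of the implications between the three conditions only one is deep: a linear form \<open>L\<close> with
  \<open>L (T g v) = 0\<close> for all \<open>g\<close> and \<open>v\<close> is a multiple of the Haar measure. Here \<open>T g v\<close>
  (\<open>cos_difference\<close>) is the sum of the translates of \<open>v\<close> by \<open>g\<close> and \<open>-g\<close> minus the sum of those by
  \<open>n g\<close> and \<open>-n g\<close>. It suffices that \<open>L f = 0\<close> whenever \<open>f\<close> has mean 0, and no continuity of \<open>L\<close>
  may be used. So \<open>f\<close> has to be written as a finite sum of functions in the ranges of operators
  \<open>T g\<close>.

  The form \<open>L\<close> is invariant under \<open>Q g = 1 - (T g)^2 / 16\<close> (\<open>contraction\<close>), which commutes with all
  translations and, as a Laurent polynomial \<open>q\<close> in the translation by \<open>g\<close>, takes the values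
  \<open>1 - sin^2 ((n + 1) t / 2) sin^2 ((n - 1) t / 2)\<close>, between 0 and 1, on the unit circle. With
  \<open>P = Q g1 \<circ> \<dots> \<circ> Q g32\<close>, if \<open>h = (\<Sum>k. P^k f)\<close> converges almost everywhere to a
  square-integrable function, then \<open>f = h - P h\<close> almost everywhere, and \<open>L f = L h - L (P h) = 0\<close>
  (lemmas \<open>difference_equation\<close> and \<open>linear_form_eq_integral\<close>).

  It remains to find \<open>g1, \<dots>, g32\<close> with \<open>(\<Sum>k. (k + 1)^2 \<parallel>P^k f\<parallel>^2) < \<infinity>\<close>; the weights give
  the convergence by the Cauchy-Schwarz inequality. For \<open>u\<close> of mean 0, the mean over \<open>g\<close> of
  \<open>\<parallel>(Q g)^k u\<parallel>^2\<close> is \<open>c k * \<parallel>u\<parallel>^2\<close>, where \<open>c k\<close> is the mean of \<open>q^(2k)\<close> over the unit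
  circle (lemma \<open>mean_energy_contraction\<close>). No characters of the group are needed for this: after
  expanding the square, it says that the mean over \<open>g\<close> of the inner product of the translates of \<open>u\<close>
  by \<open>i g\<close> and by \<open>l g\<close> vanishes for \<open>i \<noteq> l\<close>, which holds because \<open>g \<mapsto> (i - l) g\<close> preserves the
  Haar measure. As \<open>n \<noteq> 1\<close> and \<open>n \<noteq> -1\<close>, the function \<open>q\<close> equals 1 at finitely many points of the circle
  only, and \<open>c k = O(k^(-1/8))\<close> (lemma \<open>coeff_sq_symbol_power_le\<close>). The elements \<open>g1, \<dots>, g32\<close> are
  chosen one after another, each gaining one factor \<open>c k\<close> (lemma \<open>exists_translations\<close>); and
  \<open>(\<Sum>k. (k + 1)^2 * (c k)^32)\<close> converges.

  That \<open>g \<mapsto> j g\<close> preserves the Haar measure for \<open>j > 0\<close> follows from the divisibility of a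
  connected compact group (lemma \<open>nat_multiple_surj\<close>), which is proved from a spectral gap argument
  instead of duality theory. Neither this nor the uniqueness of the Haar measure needs more of
  Fubini's theorem than its version for continuous kernels.
\<close>

section \<open>Compact groups\<close>

text \<open>The multiple \<open>k g\<close> of a group element by a natural number.\<close>

primrec nat_multiple :: "nat \<Rightarrow> 'a::comm_monoid_add \<Rightarrow> 'a" where
  "nat_multiple 0 g = 0"
| "nat_multiple (Suc k) g = g + nat_multiple k g"

lemma nat_multiple_add: "nat_multiple (i + j) g = nat_multiple i g + nat_multiple j g"
  by (induction i) (simp_all add: add.assoc)

lemma nat_multiple_distrib: "nat_multiple j (g + h) = nat_multiple j g + nat_multiple j h"
  by (induction j) (simp_all add: ac_simps)

lemma nat_multiple_zero [simp]: "nat_multiple j 0 = 0"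
  by (induction j) simp_all

lemma continuous_on_nat_multiple [continuous_intros]:
  fixes f :: "'b::topological_space \<Rightarrow> 'a::topological_comm_monoid_add"
  assumes "continuous_on S f"
  shows "continuous_on S (\<lambda>x. nat_multiple j (f x))"
  by (induction j) (auto intro!: continuous_intros assms)

lemma int_multiple_eq:
  "int_multiple n g = (if n \<ge> 0 then nat_multiple (nat n) g else - nat_multiple (nat (- n)) g)"
proof -
  have "(\<Sum>i<k. g) = nat_multiple k g" for k :: nat
    by (induction k) (simp_all add: ac_simps)
  then show ?thesis by (simp add: int_multiple_def)
qed

text \<open>Uniform continuity of a continuous function on a compact group.\<close>

lemma dist_translate_le:
  fixes v :: "'a::topological_ab_group_add \<Rightarrow> 'b::metric_space"
  assumes "compact (UNIV :: 'a set)" "continuous_on UNIV v" "e > 0"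
  obtains N where "open N" "0 \<in> N" "\<And>g x. g \<in> N \<Longrightarrow> dist (v (g + x)) (v x) \<le> e"
proof -
  have "continuous_on (UNIV \<times> UNIV) (\<lambda>p :: 'a \<times> 'a. v (fst p + snd p))"
    by (rule continuous_on_compose2[OF assms(2)]) (auto intro!: continuous_intros)
  from continuous_on_prod_compactE[OF this assms(1) UNIV_I[of 0] assms(3)]
  obtain X where X: "0 \<in> X" "open X"
    "\<forall>x\<in>X \<inter> UNIV. \<forall>t\<in>UNIV. dist (v (fst (x, t) + snd (x, t))) (v (fst (0 :: 'a, t) + snd (0 :: 'a, t))) \<le> e" .
  then show ?thesis by (intro that[of X]) simp_all
qed

text \<open>Urysohn's lemma in terms of the type classes, for a compact Hausdorff type.\<close>

lemma Urysohn_compact_T2: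
  fixes S T :: "'a::t2_space set"
  assumes "compact (UNIV :: 'a set)" "closed S" "closed T" "S \<inter> T = {}"
  obtains f :: "'a \<Rightarrow> real" where "continuous_on UNIV f" "\<And>x. 0 \<le> f x" "\<And>x. f x \<le> 1"
    "\<And>x. x \<in> S \<Longrightarrow> f x = 0" "\<And>x. x \<in> T \<Longrightarrow> f x = 1"
proof -
  have "Hausdorff_space (euclidean :: 'a topology)"
    unfolding Hausdorff_space_def disjnt_def using hausdorff by (metis open_openin)
  moreover have "compact_space (euclidean :: 'a topology)"
    using assms(1) by (simp add: compact_space_def)
  ultimately have "normal_space (euclidean :: 'a topology)"
    by (intro compact_Hausdorff_or_regular_imp_normal_space) auto
  then obtain f :: "'a \<Rightarrow> real" where "continuous_map euclidean (top_of_set {0..1}) f" "f ` S \<subseteq> {0}" "f ` T \<subseteq> {1}"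
    using assms by (elim Urysohn_lemma[of _ S T 0 1]) (auto simp: disjnt_def)
  then show ?thesis
    by (intro that[of f]) (auto simp: continuous_map_in_subtopology Pi_iff image_subset_iff)
qed

text \<open>The sumset \<open>N + \<dots> + N\<close>, with \<open>r + 1\<close> summands.\<close>

primrec sumset_power :: "nat \<Rightarrow> 'a::comm_monoid_add set \<Rightarrow> 'a set" where
  "sumset_power 0 N = N"
| "sumset_power (Suc r) N = {g + h | g h. g \<in> N \<and> h \<in> sumset_power r N}"

lemma open_plus_left:
  fixes U :: "'a::topological_ab_group_add set"
  assumes "open U"
  shows "open ((+) g ` U)"
proof -
  have "(+) g ` U = (\<lambda>x. - g + x) -` U"
    by (force simp: image_iff algebra_simps)
  moreover have "open ((\<lambda>x. - g + x) -` U)"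
    by (intro open_vimage assms continuous_intros)
  ultimately show ?thesis by simp
qed

text \<open>A neighbourhood of 0 in a connected group generates it, because the union of its sumsets is open
  and closed; by compactness finitely many summands suffice.\<close>

lemma sumset_power_eq_UNIV:
  fixes N :: "'a::topological_ab_group_add set"
  assumes "compact (UNIV :: 'a set)" "connected (UNIV :: 'a set)" "open N" "0 \<in> N"
  obtains r where "sumset_power r N = UNIV"
proof -
  have op: "open (sumset_power r N)" for r
  proof (induction r)
    case (Suc r)
    have "sumset_power (Suc r) N = (\<Union>g\<in>N. (+) g ` sumset_power r N)" by auto
    then show ?case using Suc open_plus_left by (metis open_UN)
  qed (use assms in simp)
  have zero: "0 \<in> sumset_power r N" for r
    by (induction r) (use assms(4) in \<open>auto intro!: exI[of _ 0]\<close>)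
  have mono1: "sumset_power r N \<subseteq> sumset_power (Suc r) N" for r
  proof
    fix x assume "x \<in> sumset_power r N"
    with assms(4) have "\<exists>g h. x = g + h \<and> g \<in> N \<and> h \<in> sumset_power r N"
      by (intro exI[of _ 0] exI[of _ x]) simp
    then show "x \<in> sumset_power (Suc r) N" by simp
  qed
  have mono: "r \<le> s \<Longrightarrow> sumset_power r N \<subseteq> sumset_power s N" for r s
    by (rule lift_Suc_mono_le[where f = "\<lambda>r. sumset_power r N", OF mono1])
  let ?H = "\<Union>r. sumset_power r N"
  have opH: "open ?H" using op by blast
  have "open (- ?H)"
  proof (subst open_subopen, intro ballI)
    fix x assume x: "x \<in> - ?H"
    let ?V = "(\<lambda>y. x - y) -` N"
    have "open ?V" by (intro open_vimage assms continuous_intros)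
    moreover have "x \<in> ?V" using assms(4) by simp
    moreover have "?V \<subseteq> - ?H"
    proof
      fix y assume y: "y \<in> ?V"
      show "y \<in> - ?H"
      proof
        assume "y \<in> ?H"
        then obtain r where "y \<in> sumset_power r N" by blast
        with y have "\<exists>g h. x = g + h \<and> g \<in> N \<and> h \<in> sumset_power r N"
            by (intro exI[of _ "x - y"] exI[of _ y]) simp
        then have "x \<in> sumset_power (Suc r) N" by simp
        with x show False by blast
      qed
    qed
    ultimately show "\<exists>T. open T \<and> x \<in> T \<and> T \<subseteq> - ?H" by blast
  qed
  then have "?H \<inter> UNIV = {} \<or> - ?H \<inter> UNIV = {}"
    by (rule connectedD[OF assms(2) opH]) blast+
  then have H: "?H = UNIV" using zero by blast
  obtain C where C: "finite C" "UNIV \<subseteq> (\<Union>r\<in>C. sumset_power r N)"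
    by (rule compactE_image[OF assms(1), of UNIV "\<lambda>r. sumset_power r N"]) (use op H in auto)
  have "sumset_power (Max (insert 0 C)) N = UNIV"
  proof -
    have "sumset_power r N \<subseteq> sumset_power (Max (insert 0 C)) N" if "r \<in> C" for r
      using C(1) that by (intro mono Max_ge) auto
    then show ?thesis using C(2) by blast
  qed
  then show ?thesis by (rule that)
qed

section \<open>Continuous functions and finite Borel measures\<close>

lemma continuous_compact_bounded:
  fixes u :: "'a::topological_space \<Rightarrow> 'b::real_normed_vector"
  assumes "compact (UNIV :: 'a set)" "continuous_on UNIV u"
  obtains B where "B > 0" "\<And>x. norm (u x) \<le> B"
  using compact_imp_bounded[OF compact_continuous_image[OF assms(2,1)]]
  unfolding bounded_pos by auto

lemma integrable_continuous:
  fixes u :: "'a::topological_space \<Rightarrow> 'b::{banach, second_countable_topology}"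
  assumes "compact (UNIV :: 'a set)" "continuous_on UNIV u" "finite_measure M" "sets M = sets borel"
  shows "integrable M u"
proof -
  obtain B where "\<And>x. norm (u x) \<le> B"
    using continuous_compact_bounded[OF assms(1,2)] by metis
  then show ?thesis
    using assms by (intro finite_measure.integrable_const_bound[where B = B])
      (auto simp: measurable_cong_sets[OF assms(4) refl] intro: borel_measurable_continuous_onI)
qed

lemma norm_integral_le:
  fixes f :: "'a \<Rightarrow> 'b::{banach, second_countable_topology}"
  assumes "integrable M f" "integrable M g" "\<And>x. norm (f x) \<le> g x"
  shows "norm (LINT x|M. f x) \<le> (LINT x|M. g x)"
proof -
  have "norm (LINT x|M. f x) \<le> (LINT x|M. norm (f x))" by (rule integral_norm_bound)
  also have "\<dots> \<le> (LINT x|M. g x)" using assms by (intro integral_mono) auto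
  finally show ?thesis .
qed

lemma integrable_mult_bounded:
  fixes u w :: "'a \<Rightarrow> 'b::{real_normed_field, banach, second_countable_topology}"
  assumes "u \<in> borel_measurable M" "integrable M w" "\<And>x. norm (u x) \<le> B"
  shows "integrable M (\<lambda>x. u x * w x)"
proof (rule Bochner_Integration.integrable_bound)
  show "integrable M (\<lambda>x. B * norm (w x))" using assms(2) by simp
  have "B \<ge> 0" using assms(3) norm_ge_zero order_trans by blast
  then show "AE x in M. norm (u x * w x) \<le> norm (B * norm (w x))"
    using assms(3) by (auto simp: norm_mult intro!: mult_right_mono)
qed (use assms in auto)

text \<open>A kernel \<open>F\<close> that is continuous on a compact product is continuous in its first argument,
  uniformly in the second; integration against an integrable weight keeps this continuity.\<close>

lemma continuous_integral_kernel:
  fixes F :: "'x::t2_space \<times> 'y::t2_space \<Rightarrow> 'b::{real_normed_field, banach, second_countable_topology}"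
  assumes "compact (UNIV :: 'x set)" "compact (UNIV :: 'y set)" "continuous_on UNIV F"
    and "sets N = sets borel" "integrable N w"
  shows "\<And>g. integrable N (\<lambda>x. F (g, x) * w x)"
    and "continuous_on UNIV (\<lambda>g. LINT x|N. F (g, x) * w x)"
    and "\<And>g h e. (\<And>x. dist (F (g, x)) (F (h, x)) \<le> e) \<Longrightarrow>
      norm ((LINT x|N. F (g, x) * w x) - (LINT x|N. F (h, x) * w x)) \<le> e * (LINT x|N. norm (w x))"
    and "\<And>g e. e > 0 \<Longrightarrow> \<exists>X. open X \<and> g \<in> X \<and> (\<forall>h\<in>X. \<forall>x. dist (F (h, x)) (F (g, x)) \<le> e)"
proof -
  obtain B where B: "B > 0" "\<And>p. norm (F p) \<le> B"
    using continuous_compact_bounded[OF compact_Times[OF assms(1,2), simplified] assms(3)] by metis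
  have cont1: "continuous_on UNIV (\<lambda>x. F (g, x))" for g
    by (rule continuous_on_compose2[OF assms(3)]) (auto intro!: continuous_intros)
  have meas1: "(\<lambda>x. F (g, x)) \<in> borel_measurable N" for g
    unfolding measurable_cong_sets[OF assms(4) refl] by (rule borel_measurable_continuous_onI[OF cont1])
  show int1: "integrable N (\<lambda>x. F (g, x) * w x)" for g
    by (rule integrable_mult_bounded[OF meas1 assms(5) B(2)])
  define W where "W = (LINT x|N. norm (w x))"
  have W: "W \<ge> 0" by (simp add: W_def)
  have close0: "norm ((LINT x|N. F (g, x) * w x) - (LINT x|N. F (h, x) * w x)) \<le> e * W"
    if "\<And>x. dist (F (g, x)) (F (h, x)) \<le> e" for g h e
  proof -
    have "norm ((LINT x|N. F (g, x) * w x) - (LINT x|N. F (h, x) * w x)) = norm (LINT x|N. (F (g, x) - F (h, x)) * w x)"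
      by (simp add: left_diff_distrib int1)
    also have "\<dots> \<le> (LINT x|N. e * norm (w x))"
    proof (rule norm_integral_le)
      show "integrable N (\<lambda>x. (F (g, x) - F (h, x)) * w x)"
        using int1 by (simp add: left_diff_distrib)
      show "norm ((F (g, x) - F (h, x)) * w x) \<le> e * norm (w x)" for x
        using that[of x] by (simp add: norm_mult dist_norm mult_right_mono)
    qed (use assms(5) in simp)
    also have "\<dots> = e * W" by (simp add: W_def)
    finally show ?thesis .
  qed
  from close0 show "\<And>g h e. (\<And>x. dist (F (g, x)) (F (h, x)) \<le> e) \<Longrightarrow>
      norm ((LINT x|N. F (g, x) * w x) - (LINT x|N. F (h, x) * w x)) \<le> e * (LINT x|N. norm (w x))"
    by (simp add: W_def)
  show nbhd: "\<exists>X. open X \<and> g \<in> X \<and> (\<forall>h\<in>X. \<forall>x. dist (F (h, x)) (F (g, x)) \<le> e)" if "e > 0" for g and e :: real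
  proof -
    have "continuous_on (UNIV \<times> UNIV) F" using assms(3) by simp
    from continuous_on_prod_compactE[OF this assms(2) UNIV_I[of g] that]
    show ?thesis by (metis Int_UNIV_right UNIV_I)
  qed
  show "continuous_on UNIV (\<lambda>g. LINT x|N. F (g, x) * w x)"
  proof (subst continuous_on_eq_continuous_at[OF open_UNIV], intro ballI)
    fix g
    show "isCont (\<lambda>g. LINT x|N. F (g, x) * w x) g"
      unfolding isCont_def
    proof (rule tendstoI)
      fix e :: real assume "e > 0"
      then have "e / (2 * (W + 1)) > 0" using W by simp
      from nbhd[OF this, of g] obtain X where X: "open X" "g \<in> X"
        "\<And>h x. h \<in> X \<Longrightarrow> dist (F (h, x)) (F (g, x)) \<le> e / (2 * (W + 1))" by blast
      have "dist (LINT x|N. F (h, x) * w x) (LINT x|N. F (g, x) * w x) < e" if "h \<in> X" for h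
      proof -
        have "dist (LINT x|N. F (h, x) * w x) (LINT x|N. F (g, x) * w x) \<le> e / (2 * (W + 1)) * W"
          using close0[OF X(3)[OF that]] by (simp add: dist_norm)
        also have "\<dots> < e" using \<open>e > 0\<close> W by (simp add: field_simps) (smt (verit) mult_nonneg_nonneg)
        finally show ?thesis .
      qed
      with X show "\<forall>\<^sub>F h in at g. dist (LINT x|N. F (h, x) * w x) (LINT x|N. F (g, x) * w x) < e"
        by (auto simp: eventually_at_topological)
    qed
  qed
qed

text \<open>Fubini's theorem for a continuous kernel: the Borel sets of a product of non-metrizable spaces need
  not belong to the product \<sigma>-algebra, but a continuous kernel is uniformly close to one that is
  a step function of its first argument.\<close>

lemma swap_continuous_kernel:
  fixes F :: "'x::t2_space \<times> 'y::t2_space \<Rightarrow> 'b::{real_normed_field, banach, second_countable_topology}"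
  assumes "compact (UNIV :: 'x set)" "compact (UNIV :: 'y set)" "continuous_on UNIV F"
    and "finite_measure M" "sets M = sets borel" "sets N = sets borel" "integrable N w"
  shows "(LINT g|M. LINT x|N. F (g, x) * w x) = (LINT x|N. (LINT g|M. F (g, x)) * w x)"
proof -
  interpret M: finite_measure M by fact
  have spM: "space M = UNIV" using sets_eq_imp_space_eq[OF assms(5)] by simp
  obtain B where B: "B > 0" "\<And>p. norm (F p) \<le> B"
    using continuous_compact_bounded[OF compact_Times[OF assms(1,2), simplified] assms(3)] by metis
  have cont1: "continuous_on UNIV (\<lambda>x. F (g, x))" for g
    by (rule continuous_on_compose2[OF assms(3)]) (auto intro!: continuous_intros)
  have cont2: "continuous_on UNIV (\<lambda>g. F (g, x))" for x
    by (rule continuous_on_compose2[OF assms(3)]) (auto intro!: continuous_intros)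
  note kernel = continuous_integral_kernel[OF assms(1-3,6,7)]
  note int1 = kernel(1) and cont = kernel(2) and nbhd = kernel(4)
  have int2: "integrable M (\<lambda>g. F (g, x))" for x
    by (rule integrable_continuous[OF assms(1) cont2 assms(4,5)])
  define W where "W = (LINT x|N. norm (w x))"
  have W: "W \<ge> 0" by (simp add: W_def)
  note close = kernel(3)[folded W_def]
  let ?l = "LINT g|M. LINT x|N. F (g, x) * w x" and ?r = "LINT x|N. (LINT g|M. F (g, x)) * w x"
  have "norm (?l - ?r) \<le> 0 + e" if e: "e > 0" for e
  proof -
    define m where "m = measure M UNIV"
    have m: "m \<ge> 0" by (simp add: m_def)
    define d where "d = e / (2 * W * m + 1)"
    have d: "d > 0" using e W m by (simp add: d_def add_nonneg_pos)
    have dW: "2 * (d * W * m) \<le> e"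
    proof -
      have "2 * (d * W * m) \<le> d * (2 * W * m + 1)" using d by (simp add: algebra_simps)
      also have "\<dots> = e" using W m by (simp add: d_def add_nonneg_pos less_imp_neq[symmetric])
      finally show ?thesis .
    qed
    from nbhd[OF d] obtain X where X: "\<And>g. open (X g)" "\<And>g. g \<in> X g"
      "\<And>g h x. h \<in> X g \<Longrightarrow> dist (F (h, x)) (F (g, x)) \<le> d" by metis
    obtain C where C: "finite C" "UNIV \<subseteq> (\<Union>g\<in>C. X g)"
      by (rule compactE_image[OF assms(1), of UNIV X]) (use X(1,2) in auto)
    obtain n c where nc: "C = c ` {i::nat. i < n}"
      using finite_imp_nat_seg_image_inj_on[OF C(1)] by metis
    define A where "A = disjointed (\<lambda>i. if i < n then X (c i) else {})"
    have A_sets: "A i \<in> sets borel" for i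
      unfolding A_def disjointed_def using X(1) by (auto intro!: sets.Diff sets.finite_UN split: if_splits)
    have A_disj: "disjoint_family A" unfolding A_def by (rule disjoint_family_disjointed)
    have A_sub: "A i \<subseteq> (if i < n then X (c i) else {})" for i
      unfolding A_def by (rule disjointed_subset)
    have A_un: "(\<Union>i. A i) = UNIV"
      unfolding A_def UN_disjointed_eq using C(2) nc by (fastforce split: if_splits)
    define s where "s g = c (THE i. g \<in> A i)" for g
    have s_eq: "s g = c i" if "g \<in> A i" for g i
    proof -
      have "(THE i. g \<in> A i) = i"
        using that A_disj by (intro the_equality) (auto simp: disjoint_family_on_def)
      then show ?thesis by (simp add: s_def)
    qed
    have rep: "f (s g) = (\<Sum>i<n. indicator (A i) g *\<^sub>R f (c i))" for g and f :: "'x \<Rightarrow> 'b"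
    proof -
      obtain i where i: "g \<in> A i" using A_un by blast
      then have "i < n" using A_sub[of i] by (auto split: if_splits)
      have "indicator (A k) g = (if k = i then 1 else 0 :: real)" for k
        using i A_disj by (auto simp: disjoint_family_on_def indicator_def)
      then show ?thesis using \<open>i < n\<close> s_eq[OF i] by (simp add: if_distrib[of "\<lambda>r. r *\<^sub>R _"] cong: if_cong)
    qed
    have dist_s: "dist (F (g, x)) (F (s g, x)) \<le> d" for g x
    proof -
      obtain i where i: "g \<in> A i" using A_un by blast
      then have "g \<in> X (c i)" using A_sub[of i] by (auto split: if_splits)
      then show ?thesis using X(3) s_eq[OF i] by simp
    qed
    \<comment> \<open>The function \<open>s\<close> has finitely many values, so for it the claim is the linearity of the integral.\<close>
    have hb: "has_bochner_integral M (\<lambda>g. f (s g)) (\<Sum>i<n. measure M (A i) *\<^sub>R f (c i))" for f :: "'x \<Rightarrow> 'b"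
      unfolding rep
      by (intro has_bochner_integral_sum has_bochner_integral_scaleR_left has_bochner_integral_real_indicator)
        (simp_all add: A_sets assms(5) M.emeasure_finite less_top[symmetric])
    have norm_int: "norm ((LINT g|M. f g) - (LINT g|M. f (s g))) \<le> b * m"
      if "integrable M f" "\<And>g. norm (f g - f (s g)) \<le> b" for f :: "'x \<Rightarrow> 'b" and b
    proof -
      have i: "integrable M (\<lambda>g. f (s g))" using hb integrable.intros by blast
      have "norm ((LINT g|M. f g) - (LINT g|M. f (s g))) = norm (LINT g|M. f g - f (s g))"
        using that i by simp
      also have "\<dots> \<le> (LINT g|M. b)"
        using that i by (intro norm_integral_le) auto
      also have "\<dots> = b * m" by (simp add: m_def spM)
      finally show ?thesis .
    qed
    have 1: "norm (?l - (LINT g|M. LINT x|N. F (s g, x) * w x)) \<le> d * W * m"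
      using close[OF dist_s] by (intro norm_int integrable_continuous assms cont) auto
    have "(LINT g|M. LINT x|N. F (s g, x) * w x) = (\<Sum>i<n. measure M (A i) *\<^sub>R (LINT x|N. F (c i, x) * w x))"
      using has_bochner_integral_integral_eq[OF hb[of "\<lambda>g. LINT x|N. F (g, x) * w x"]] .
    also have "\<dots> = (LINT x|N. (\<Sum>i<n. measure M (A i) *\<^sub>R (F (c i, x) * w x)))"
      using int1 by (simp add: Bochner_Integration.integral_sum)
    also have "\<dots> = (LINT x|N. (LINT g|M. F (s g, x)) * w x)"
      by (simp add: has_bochner_integral_integral_eq[OF hb[of "\<lambda>g. F (g, _)"]] sum_distrib_right)
    finally have 2: "(LINT g|M. LINT x|N. F (s g, x) * w x) = (LINT x|N. (LINT g|M. F (s g, x)) * w x)" .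
    have bd: "norm ((LINT g|M. F (g, x)) - (LINT g|M. F (s g, x))) \<le> d * m" for x
      using dist_s by (intro norm_int int2) (auto simp: dist_norm)
    have ms: "integrable N (\<lambda>x. (LINT g|M. F (s g, x)) * w x)"
      using int1 by (simp add: has_bochner_integral_integral_eq[OF hb[of "\<lambda>g. F (g, _)"]] sum_distrib_right)
    have ms': "integrable N (\<lambda>x. (LINT g|M. F (g, x)) * w x)"
    proof -
      have c': "continuous_on UNIV (\<lambda>p. F (snd p, fst p))"
        by (rule continuous_on_compose2[OF assms(3)]) (auto intro!: continuous_intros)
      have "continuous_on UNIV (\<lambda>x. LINT g|M. F (g, x))"
        using continuous_integral_kernel(2)[OF assms(2,1) c' assms(5), of "\<lambda>_. 1"] by simp
      then have me: "(\<lambda>x. LINT g|M. F (g, x)) \<in> borel_measurable N"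
        unfolding measurable_cong_sets[OF assms(6) refl] by (rule borel_measurable_continuous_onI)
      have "norm (LINT g|M. F (g, x)) \<le> B * m" for x
      proof -
        have "norm (LINT g|M. F (g, x)) \<le> (LINT g|M. B)"
          using B(2) int2 by (intro norm_integral_le) auto
        then show ?thesis by (simp add: m_def spM mult.commute)
      qed
      from integrable_mult_bounded[OF me assms(7) this] show ?thesis .
    qed
    have "norm ((LINT x|N. (LINT g|M. F (s g, x)) * w x) - ?r) = norm (LINT x|N. ((LINT g|M. F (s g, x)) - (LINT g|M. F (g, x))) * w x)"
      by (subst Bochner_Integration.integral_diff[OF ms ms', symmetric]) (simp only: left_diff_distrib)
    also have "\<dots> \<le> (LINT x|N. d * m * norm (w x))"
    proof (rule norm_integral_le)
      show "integrable N (\<lambda>x. ((LINT g|M. F (s g, x)) - (LINT g|M. F (g, x))) * w x)"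
        unfolding left_diff_distrib by (rule Bochner_Integration.integrable_diff[OF ms ms'])
      show "norm (((LINT g|M. F (s g, x)) - (LINT g|M. F (g, x))) * w x) \<le> d * m * norm (w x)" for x
        using bd[of x] by (simp only: norm_mult norm_minus_commute[of "LINT g|M. F (g, x)"] mult_right_mono norm_ge_zero)
    qed (use assms(7) in simp)
    also have "\<dots> = d * W * m" by (simp add: W_def)
    finally have 3: "norm ((LINT x|N. (LINT g|M. F (s g, x)) * w x) - ?r) \<le> d * W * m" .
    have "norm (?l - ?r) \<le> d * W * m + d * W * m"
      using norm_triangle_le[OF add_mono[OF 1 3]] 2 by simp
    with dW show ?thesis by linarith
  qed
  then have "norm (?l - ?r) \<le> 0" by (rule field_le_epsilon)
  then show "?l = ?r" by simp
qed

section \<open>The Haar measure\<close>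

text \<open>A normalised Haar measure on a compact group, without connectedness.\<close>

locale haar_measure =
  fixes \<mu> :: "'a::{topological_ab_group_add, t2_space} measure"
  assumes compact_UNIV: "compact (UNIV :: 'a set)" and haar: "normalised_haar \<mu>"
begin

lemma sets_haar [simp, measurable_cong]: "sets \<mu> = sets borel"
  and translate_emeasure: "A \<in> sets borel \<Longrightarrow> emeasure \<mu> ((\<lambda>x. g + x) ` A) = emeasure \<mu> A"
  using haar by (simp_all add: normalised_haar_def)

lemma space_haar [simp]: "space \<mu> = UNIV"
  using sets_eq_imp_space_eq[OF sets_haar] by simp

sublocale prob_space \<mu>
  using haar by (simp add: normalised_haar_def)

lemma finite_haar: "finite_measure \<mu>"
  by (rule finite_measure_axioms)

lemma borel_measurable_haar: "borel_measurable \<mu> = borel_measurable borel"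
  by (rule measurable_cong_sets) simp_all

lemma continuous_measurable: "continuous_on UNIV u \<Longrightarrow> u \<in> borel_measurable \<mu>"
  unfolding borel_measurable_haar by (rule borel_measurable_continuous_onI)

lemma continuous_integrable:
  fixes u :: "'a \<Rightarrow> 'b::{banach, second_countable_topology}"
  shows "continuous_on UNIV u \<Longrightarrow> integrable \<mu> u"
  by (rule integrable_continuous[OF compact_UNIV _ finite_haar sets_haar])

lemma continuous_translate:
  "continuous_on UNIV u \<Longrightarrow> continuous_on UNIV (\<lambda>x. u (g + x))" for u :: "'a \<Rightarrow> 'b::topological_space"
  by (rule continuous_on_compose2[of UNIV u]) (auto intro!: continuous_intros)

lemma measurable_plus [measurable]: "(\<lambda>x. g + x) \<in> \<mu> \<rightarrow>\<^sub>M \<mu>"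
proof -
  have "(\<lambda>x::'a. g + x) \<in> borel_measurable borel"
    by (intro borel_measurable_continuous_onI continuous_intros)
  then show ?thesis by (simp add: measurable_cong_sets[OF sets_haar sets_haar])
qed

lemma distr_plus: "distr \<mu> \<mu> (\<lambda>x. g + x) = \<mu>"
proof (rule measure_eqI)
  fix A assume "A \<in> sets (distr \<mu> \<mu> (\<lambda>x. g + x))"
  then have A: "A \<in> sets borel" by simp
  have "(\<lambda>x. g + x) -` A = (\<lambda>x. - g + x) ` A"
    by (force simp: image_iff algebra_simps)
  then show "emeasure (distr \<mu> \<mu> (\<lambda>x. g + x)) A = emeasure \<mu> A"
    using A translate_emeasure[OF A, of "- g"] by (subst emeasure_distr) auto
qed simp

lemma measurable_translate:
  "u \<in> borel_measurable \<mu> \<Longrightarrow> (\<lambda>x. u (g + x)) \<in> borel_measurable \<mu>"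
  by (rule measurable_compose[OF measurable_plus])

lemma integral_translate:
  fixes u :: "'a \<Rightarrow> 'b::{banach, second_countable_topology}"
  shows "u \<in> borel_measurable \<mu> \<Longrightarrow> (LINT x|\<mu>. u (g + x)) = (LINT x|\<mu>. u x)"
  using integral_distr[OF measurable_plus, of u g] by (simp add: distr_plus)

lemma integrable_translate:
  fixes u :: "'a \<Rightarrow> 'b::{banach, second_countable_topology}"
  shows "integrable \<mu> u \<Longrightarrow> integrable \<mu> (\<lambda>x. u (g + x))"
  using integrable_distr_eq[OF measurable_plus, of u g] by (simp add: distr_plus)

lemma AE_translate:
  assumes "AE x in \<mu>. P x"
  shows "AE x in \<mu>. P (g + x)"
proof -
  have "AE x in distr \<mu> \<mu> (\<lambda>x. g + x). P x" using assms by (simp only: distr_plus)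
  then show ?thesis by (rule AE_distrD[OF measurable_plus])
qed

lemma continuous_correlation:
  fixes u w :: "'a \<Rightarrow> 'b::{real_normed_field, banach, second_countable_topology}"
  assumes "continuous_on UNIV u" "integrable \<mu> w"
  shows "continuous_on UNIV (\<lambda>g. LINT x|\<mu>. u (g + x) * w x)"
proof -
  have "continuous_on UNIV (\<lambda>p :: 'a \<times> 'a. u (fst p + snd p))"
    by (rule continuous_on_compose2[OF assms(1)]) (auto intro!: continuous_intros)
  from continuous_integral_kernel(2)[OF compact_UNIV compact_UNIV this sets_haar assms(2)]
  show ?thesis by simp
qed

text \<open>An invariant probability measure has the same integrals of continuous functions as the Haar
  measure, even if it is not regular: integrate \<open>u (g + x)\<close> in both variables and use the invariance in
  each order of integration.\<close>

lemma integral_eq_if_invariant: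
  fixes u :: "'a \<Rightarrow> 'b::{real_normed_field, banach, second_countable_topology}"
  assumes "prob_space \<nu>" "sets \<nu> = sets borel" "continuous_on UNIV u"
    and "\<And>t. (LINT x|\<nu>. u (t + x)) = (LINT x|\<nu>. u x)"
  shows "(LINT x|\<nu>. u x) = (LINT x|\<mu>. u x)"
proof -
  interpret \<nu>: prob_space \<nu> by fact
  have sp: "space \<nu> = UNIV" using sets_eq_imp_space_eq[OF assms(2)] by simp
  have "continuous_on UNIV (\<lambda>p :: 'a \<times> 'a. u (fst p + snd p))"
    by (rule continuous_on_compose2[OF assms(3)]) (auto intro!: continuous_intros)
  from swap_continuous_kernel[OF compact_UNIV compact_UNIV this finite_haar sets_haar assms(2), of "\<lambda>_. 1"]
  have "(LINT g|\<mu>. LINT x|\<nu>. u (g + x)) = (LINT x|\<nu>. LINT g|\<mu>. u (g + x))" by simp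
  moreover have "(LINT g|\<mu>. u (g + x)) = (LINT g|\<mu>. u g)" for x
    using integral_translate[OF continuous_measurable[OF assms(3)], of x] by (simp add: add.commute)
  ultimately show ?thesis
    using \<nu>.prob_space by (simp add: assms(4) prob_space[simplified] sp)
qed

lemma compact_imp_sets: "compact K \<Longrightarrow> K \<in> sets borel" for K :: "'a set"
  by (simp add: borel_closed compact_imp_closed)

text \<open>By Urysohn functions and outer regularity the two measures agree on compact sets, and then on all
  Borel sets by inner regularity.\<close>

lemma haar_unique:
  assumes "normalised_haar \<nu>"
  shows "\<nu> = \<mu>"
proof -
  interpret \<nu>: haar_measure \<nu> by unfold_locales (use compact_UNIV assms in auto)
  have le: "emeasure M' K \<le> emeasure M K"
    if M: "haar_measure M" "haar_measure M'" and K: "compact K" for M M' :: "'a measure" and K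
  proof -
    interpret M: haar_measure M by fact
    interpret M': haar_measure M' by fact
    have "emeasure M' K \<le> emeasure M U" if U: "K \<subseteq> U" "open U" for U
    proof -
      obtain f :: "'a \<Rightarrow> real" where f: "continuous_on UNIV f" "\<And>x. 0 \<le> f x" "\<And>x. f x \<le> 1"
        "\<And>x. x \<in> - U \<Longrightarrow> f x = 0" "\<And>x. x \<in> K \<Longrightarrow> f x = 1"
      proof (rule Urysohn_compact_T2[OF compact_UNIV, of "- U" K])
        show "closed (- U)" "closed K" "- U \<inter> K = {}"
          using U K by (auto intro: compact_imp_closed)
      qed blast
      have "emeasure M' K = (\<integral>\<^sup>+x. indicator K x \<partial>M')"
        using compact_imp_sets[OF K] by simp
      also have "\<dots> \<le> (\<integral>\<^sup>+x. ennreal (f x) \<partial>M')"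
        using f by (intro nn_integral_mono) (auto simp: indicator_def)
      also have "\<dots> = ennreal (LINT x|M'. f x)"
        using f M'.continuous_integrable[OF f(1)] by (intro nn_integral_eq_integral) auto
      also have "(LINT x|M'. f x) = (LINT x|M. f x)"
        by (rule M.integral_eq_if_invariant[OF M'.prob_space_axioms M'.sets_haar f(1)])
          (rule M'.integral_translate[OF M'.continuous_measurable[OF f(1)]])
      also have "ennreal \<dots> = (\<integral>\<^sup>+x. ennreal (f x) \<partial>M)"
        using f M.continuous_integrable[OF f(1)] by (intro nn_integral_eq_integral[symmetric]) auto
      also have "\<dots> \<le> (\<integral>\<^sup>+x. indicator U x \<partial>M)"
        using f by (intro nn_integral_mono) (auto simp: indicator_def)
      also have "\<dots> = emeasure M U" using U by simp
      finally show ?thesis .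
    qed
    then have "emeasure M' K \<le> (INF U\<in>{U. K \<subseteq> U \<and> open U}. emeasure M U)"
      by (intro INF_greatest) auto
    also have "\<dots> = emeasure M K"
      using M.haar compact_imp_sets[OF K] unfolding normalised_haar_def by metis
    finally show ?thesis .
  qed
  have eq: "emeasure \<nu> K = emeasure \<mu> K" if "compact K" for K
    using le[OF haar_measure_axioms \<nu>.haar_measure_axioms that]
      le[OF \<nu>.haar_measure_axioms haar_measure_axioms that] by (rule antisym)
  show ?thesis
  proof (rule measure_eqI)
    fix A assume "A \<in> sets \<nu>"
    then have A: "A \<in> sets borel" by simp
    have "emeasure \<nu> A = (SUP K\<in>{K. K \<subseteq> A \<and> compact K}. emeasure \<nu> K)"
      using assms A by (auto simp: normalised_haar_def)
    also have "\<dots> = (SUP K\<in>{K. K \<subseteq> A \<and> compact K}. emeasure \<mu> K)"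
      using eq by (intro SUP_cong) auto
    also have "\<dots> = emeasure \<mu> A"
      using haar A by (auto simp: normalised_haar_def)
    finally show "emeasure \<nu> A = emeasure \<mu> A" .
  qed simp
qed

text \<open>Every open set that is not empty has positive measure, as finitely many of its translates cover
  the group.\<close>

lemma open_measure_pos:
  assumes "open U" "x \<in> U"
  shows "measure \<mu> U > 0"
proof (rule ccontr)
  assume "\<not> measure \<mu> U > 0"
  then have 0: "emeasure \<mu> U = 0" by (simp add: emeasure_eq_measure zero_less_measure_iff)
  have U: "U \<in> sets borel" using assms by simp
  have op: "open ((\<lambda>y. g + y) ` U)" for g by (rule open_plus_left[OF assms(1)])
  have un: "(\<Union>g. (\<lambda>y. g + y) ` U) = UNIV"
  proof -
    have "z = (z - x) + x" for z by simp
    then show ?thesis using assms(2) by blast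
  qed
  obtain C where C: "finite C" "UNIV \<subseteq> (\<Union>g\<in>C. (\<lambda>y. g + y) ` U)"
    by (rule compactE_image[where C = UNIV and f = "\<lambda>g. (\<lambda>y. g + y) ` U", OF compact_UNIV op]) (use un in simp_all)
  have "emeasure \<mu> (\<Union>g\<in>C. (\<lambda>y. g + y) ` U) \<le> (\<Sum>g\<in>C. emeasure \<mu> ((\<lambda>y. g + y) ` U))"
    using open_plus_left[OF assms(1)] C(1) by (intro emeasure_subadditive_finite) auto
  also have "\<dots> = 0" using translate_emeasure[OF U] 0 by simp
  finally show False using C(2) emeasure_space_1 by (simp add: top.extremum_unique)
qed

end

section \<open>Square-integrable functions\<close>

context haar_measure begin

text \<open>The square of the norm of \<open>L^2\<close>.\<close>

definition l2sq :: "('a \<Rightarrow> complex) \<Rightarrow> real" where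
  "l2sq u = (LINT x|\<mu>. (cmod (u x))\<^sup>2)"

abbreviation L2 :: "('a \<Rightarrow> complex) set" where
  "L2 \<equiv> square_integrable \<mu>"

lemma L2_measurable: "u \<in> L2 \<Longrightarrow> u \<in> borel_measurable \<mu>"
  and L2_integrable_sq: "u \<in> L2 \<Longrightarrow> integrable \<mu> (\<lambda>x. (cmod (u x))\<^sup>2)"
  by (simp_all add: square_integrable_def)

lemma l2sq_nonneg: "l2sq u \<ge> 0"
  by (simp add: l2sq_def)

lemma L2_bounded:
  assumes "w \<in> L2" "u \<in> borel_measurable \<mu>" "\<And>x. cmod (u x) \<le> B * cmod (w x)"
  shows "u \<in> L2"
proof -
  have "integrable \<mu> (\<lambda>x. (cmod (u x))\<^sup>2)"
  proof (rule Bochner_Integration.integrable_bound)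
    show "integrable \<mu> (\<lambda>x. B\<^sup>2 * (cmod (w x))\<^sup>2)"
      using L2_integrable_sq[OF assms(1)] by simp
    show "AE x in \<mu>. norm ((cmod (u x))\<^sup>2) \<le> norm (B\<^sup>2 * (cmod (w x))\<^sup>2)"
    proof (rule AE_I2)
      fix x
      have "(cmod (u x))\<^sup>2 \<le> (B * cmod (w x))\<^sup>2" by (rule power_mono[OF assms(3) norm_ge_zero])
      then show "norm ((cmod (u x))\<^sup>2) \<le> norm (B\<^sup>2 * (cmod (w x))\<^sup>2)" by (simp add: power_mult_distrib)
    qed
  qed (use assms(2) in measurable)
  then show ?thesis using assms(2) by (simp add: square_integrable_def)
qed

lemma norm_add_sq: "(cmod (a + b))\<^sup>2 \<le> 2 * (cmod a)\<^sup>2 + 2 * (cmod b)\<^sup>2"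
proof -
  have "(cmod (a + b))\<^sup>2 \<le> (cmod a + cmod b)\<^sup>2" by (intro power_mono norm_triangle_ineq) simp
  also have "\<dots> \<le> 2 * (cmod a)\<^sup>2 + 2 * (cmod b)\<^sup>2"
    using sum_squares_bound[of "cmod a" "cmod b"] by (simp add: power2_sum)
  finally show ?thesis .
qed

lemma
  assumes "u \<in> L2" "w \<in> L2"
  shows L2_add: "(\<lambda>x. u x + w x) \<in> L2"
    and l2sq_add_le: "l2sq (\<lambda>x. u x + w x) \<le> 2 * l2sq u + 2 * l2sq w"
proof -
  note [measurable] = L2_measurable[OF assms(1)] L2_measurable[OF assms(2)]
  have b: "integrable \<mu> (\<lambda>x. 2 * (cmod (u x))\<^sup>2 + 2 * (cmod (w x))\<^sup>2)"
    using assms[THEN L2_integrable_sq] by simp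
  have a: "integrable \<mu> (\<lambda>x. (cmod (u x + w x))\<^sup>2)"
    by (rule Bochner_Integration.integrable_bound[OF b])
      (auto intro!: order_trans[OF norm_add_sq] simp del: norm_ge_zero)
  show "(\<lambda>x. u x + w x) \<in> L2" using a by (simp add: square_integrable_def)
  have "l2sq (\<lambda>x. u x + w x) \<le> (LINT x|\<mu>. 2 * (cmod (u x))\<^sup>2 + 2 * (cmod (w x))\<^sup>2)"
    unfolding l2sq_def by (intro integral_mono a b norm_add_sq)
  also have "\<dots> = 2 * l2sq u + 2 * l2sq w"
    using assms[THEN L2_integrable_sq] by (simp add: l2sq_def)
  finally show "l2sq (\<lambda>x. u x + w x) \<le> 2 * l2sq u + 2 * l2sq w" .
qed

lemma L2_cmult: "u \<in> L2 \<Longrightarrow> (\<lambda>x. c * u x) \<in> L2"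
  by (rule L2_bounded[where B = "cmod c" and w = u]) (auto simp: norm_mult dest: L2_measurable)

lemma l2sq_cmult: "l2sq (\<lambda>x. c * u x) = (cmod c)\<^sup>2 * l2sq u"
  by (simp add: l2sq_def norm_mult power_mult_distrib)

lemma L2_diff: "u \<in> L2 \<Longrightarrow> w \<in> L2 \<Longrightarrow> (\<lambda>x. u x - w x) \<in> L2"
  using L2_add[of u "\<lambda>x. - 1 * w x"] L2_cmult[of w "- 1"] by simp

lemma L2_continuous: "continuous_on UNIV u \<Longrightarrow> u \<in> L2"
  unfolding square_integrable_def
  by (auto intro!: continuous_measurable continuous_integrable continuous_intros)

lemma L2_const: "(\<lambda>x. c) \<in> L2"
  by (rule L2_continuous) simp

lemma L2_translate: "u \<in> L2 \<Longrightarrow> (\<lambda>x. u (g + x)) \<in> L2"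
  using measurable_translate[of u g] integrable_translate[of "\<lambda>x. (cmod (u x))\<^sup>2" g]
  by (auto simp: square_integrable_def)

lemma l2sq_translate: "u \<in> L2 \<Longrightarrow> l2sq (\<lambda>x. u (g + x)) = l2sq u"
  unfolding l2sq_def by (intro integral_translate[of "\<lambda>x. (cmod (u x))\<^sup>2"]) (auto dest: L2_measurable)

lemma L2_sum: "finite I \<Longrightarrow> (\<And>i. i \<in> I \<Longrightarrow> u i \<in> L2) \<Longrightarrow> (\<lambda>x. \<Sum>i\<in>I. u i x) \<in> L2"
  by (induction I rule: finite_induct) (auto intro: L2_add L2_const)

lemma L2_integrable_mult:
  assumes "u \<in> L2" "w \<in> L2"
  shows "integrable \<mu> (\<lambda>x. u x * w x)" "t > 0 \<Longrightarrow> cmod (LINT x|\<mu>. u x * w x) \<le> t * l2sq u + l2sq w / t"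
proof -
  note [measurable] = L2_measurable[OF assms(1)] L2_measurable[OF assms(2)]
  have i: "integrable \<mu> (\<lambda>x. t * (cmod (u x))\<^sup>2 + (cmod (w x))\<^sup>2 / t)" for t
    using assms[THEN L2_integrable_sq] by simp
  have le: "cmod (a * b) \<le> t * (cmod a)\<^sup>2 + (cmod b)\<^sup>2 / t" if "t > 0" for a b t
  proof -
    have "0 \<le> (t * cmod a - cmod b)\<^sup>2" by simp
    then have "2 * t * (cmod a * cmod b) \<le> t\<^sup>2 * (cmod a)\<^sup>2 + (cmod b)\<^sup>2"
      by (simp add: power2_diff power_mult_distrib algebra_simps)
    moreover have "t * (cmod a * cmod b) \<ge> 0" using that by simp
    moreover have "t * (t * (cmod a)\<^sup>2 + (cmod b)\<^sup>2 / t) = t\<^sup>2 * (cmod a)\<^sup>2 + (cmod b)\<^sup>2"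
      using that by (simp add: distrib_left power2_eq_square mult.assoc)
    ultimately have "t * (cmod a * cmod b) \<le> t * (t * (cmod a)\<^sup>2 + (cmod b)\<^sup>2 / t)"
      by linarith
    then show ?thesis using that by (simp add: norm_mult)
  qed
  show a: "integrable \<mu> (\<lambda>x. u x * w x)"
  proof (rule Bochner_Integration.integrable_bound[OF i[of 1]])
    show "AE x in \<mu>. norm (u x * w x) \<le> norm (1 * (cmod (u x))\<^sup>2 + (cmod (w x))\<^sup>2 / 1)"
      using le[of 1] by (intro AE_I2) (simp add: order_trans[OF _ abs_ge_self])
  qed measurable
  assume t: "t > 0"
  have "cmod (LINT x|\<mu>. u x * w x) \<le> (LINT x|\<mu>. t * (cmod (u x))\<^sup>2 + (cmod (w x))\<^sup>2 / t)"
    by (intro norm_integral_le a i le t)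
  also have "\<dots> = t * l2sq u + l2sq w / t"
    using assms[THEN L2_integrable_sq] by (simp add: l2sq_def)
  finally show "cmod (LINT x|\<mu>. u x * w x) \<le> t * l2sq u + l2sq w / t" .
qed

lemma L2_integrable: "u \<in> L2 \<Longrightarrow> integrable \<mu> u"
  using L2_integrable_mult(1)[OF _ L2_const[of 1]] by simp

lemma L2_cnj: "u \<in> L2 \<Longrightarrow> (\<lambda>x. cnj (u x)) \<in> L2"
proof (rule L2_bounded[where B = 1 and w = u])
  assume "u \<in> L2"
  note [measurable] = L2_measurable[OF this]
  have [measurable]: "cnj \<in> borel_measurable borel"
    by (intro borel_measurable_continuous_onI continuous_intros)
  show "(\<lambda>x. cnj (u x)) \<in> borel_measurable \<mu>" by measurable
qed auto

text \<open>Membership in the \<open>L^2\<close>-closure of the continuous functions. Lemma \<open>L2_approximable\<close> shows that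
  every square-integrable function belongs to it, by way of regularity and simple functions.\<close>

definition approximable :: "('a \<Rightarrow> complex) \<Rightarrow> bool" where
  "approximable u \<longleftrightarrow> (\<forall>e>0. \<exists>w. continuous_on UNIV w \<and> l2sq (\<lambda>x. u x - w x) < e)"

lemma approximable_add:
  assumes "u \<in> L2" "v \<in> L2" "approximable u" "approximable v"
  shows "approximable (\<lambda>x. u x + v x)"
  unfolding approximable_def
proof (intro allI impI)
  fix e :: real assume "e > 0"
  then have "e / 4 > 0" by simp
  then obtain w w' where w: "continuous_on UNIV w" "l2sq (\<lambda>x. u x - w x) < e / 4"
    "continuous_on UNIV w'" "l2sq (\<lambda>x. v x - w' x) < e / 4"
    using assms(3,4) unfolding approximable_def by meson
  have "l2sq (\<lambda>x. (u x - w x) + (v x - w' x)) \<le> 2 * l2sq (\<lambda>x. u x - w x) + 2 * l2sq (\<lambda>x. v x - w' x)"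
    by (intro l2sq_add_le L2_diff assms L2_continuous w)
  also have "\<dots> < e" using w by simp
  finally have "l2sq (\<lambda>x. u x + v x - (w x + w' x)) < e" by (simp add: algebra_simps)
  then show "\<exists>w. continuous_on UNIV w \<and> l2sq (\<lambda>x. u x + v x - w x) < e"
    using w by (intro exI[of _ "\<lambda>x. w x + w' x"]) (auto intro!: continuous_intros)
qed

lemma approximable_cmult:
  assumes "approximable u"
  shows "approximable (\<lambda>x. c * u x)"
  unfolding approximable_def
proof (intro allI impI)
  fix e :: real assume e: "e > 0"
  have c: "(cmod c)\<^sup>2 + 1 > 0" by (simp add: add_nonneg_pos)
  obtain w where w: "continuous_on UNIV w" "l2sq (\<lambda>x. u x - w x) < e / ((cmod c)\<^sup>2 + 1)"
    using assms e c unfolding approximable_def by (meson divide_pos_pos)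
  have "l2sq (\<lambda>x. c * u x - c * w x) = (cmod c)\<^sup>2 * l2sq (\<lambda>x. u x - w x)"
    using l2sq_cmult[of c "\<lambda>x. u x - w x"] by (simp add: algebra_simps)
  also have "\<dots> \<le> ((cmod c)\<^sup>2 + 1) * l2sq (\<lambda>x. u x - w x)"
    by (simp add: l2sq_nonneg mult_right_mono)
  also have "\<dots> < e" using w(2) c by (simp add: field_simps)
  finally show "\<exists>w. continuous_on UNIV w \<and> l2sq (\<lambda>x. c * u x - w x) < e"
    using w by (intro exI[of _ "\<lambda>x. c * w x"]) (auto intro!: continuous_intros)
qed

lemma approximable_indicator:
  assumes "A \<in> sets borel"
  shows "approximable (indicator A)"
  unfolding approximable_def
proof (intro allI impI)
  fix e :: real assume e: "e > 0"
  have fin: "emeasure \<mu> A < \<infinity>" by (simp add: emeasure_finite less_top[symmetric])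
  have "\<exists>K. K \<subseteq> A \<and> compact K \<and> measure \<mu> A - e / 2 < measure \<mu> K"
  proof (cases "measure \<mu> A = 0")
    case True
    then show ?thesis using e by (intro exI[of _ "{}"]) auto
  next
    case False
    then have "ennreal (measure \<mu> A - e / 2) < emeasure \<mu> A"
      using e by (simp add: emeasure_eq_measure ennreal_less_iff zero_less_measure_iff measure_nonneg)
        (simp add: ennreal_lessI zero_less_measure_iff)
    also have "emeasure \<mu> A = (SUP K\<in>{K. K \<subseteq> A \<and> compact K}. emeasure \<mu> K)"
      using haar assms by (auto simp: normalised_haar_def)
    finally obtain K where "K \<subseteq> A" "compact K" "ennreal (measure \<mu> A - e / 2) < emeasure \<mu> K"
      by (auto simp: less_SUP_iff)
    then show ?thesis
      by (intro exI[of _ K]) (metis emeasure_eq_measure ennreal_leI linorder_not_le)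
  qed
  then obtain K where K: "K \<subseteq> A" "compact K" "measure \<mu> A - e / 2 < measure \<mu> K" by blast
  have "emeasure \<mu> A < ennreal (measure \<mu> A + e / 2)"
    using e by (simp add: emeasure_eq_measure ennreal_less_iff)
  moreover have "emeasure \<mu> A = (INF U\<in>{U. A \<subseteq> U \<and> open U}. emeasure \<mu> U)"
    using haar assms by (auto simp: normalised_haar_def)
  ultimately obtain U where U: "A \<subseteq> U" "open U" "emeasure \<mu> U < ennreal (measure \<mu> A + e / 2)"
    by (auto simp: INF_less_iff)
  then have U3: "measure \<mu> U < measure \<mu> A + e / 2"
    by (simp add: emeasure_eq_measure ennreal_less_iff)
  have Ks: "K \<in> sets borel" by (rule compact_imp_sets[OF K(2)])
  obtain f :: "'a \<Rightarrow> real" where f: "continuous_on UNIV f" "\<And>x. 0 \<le> f x" "\<And>x. f x \<le> 1"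
    "\<And>x. x \<in> - U \<Longrightarrow> f x = 0" "\<And>x. x \<in> K \<Longrightarrow> f x = 1"
  proof (rule Urysohn_compact_T2[OF compact_UNIV, of "- U" K])
    show "closed (- U)" "closed K" "- U \<inter> K = {}"
      using U K by (auto intro: compact_imp_closed)
  qed blast
  define w where "w x = complex_of_real (f x)" for x
  have w: "continuous_on UNIV w" unfolding w_def using f(1) by (intro continuous_intros)
  have le: "(cmod (indicator A x - w x))\<^sup>2 \<le> indicator (U - K) x" for x
  proof (cases "x \<in> U - K")
    case True
    have "indicator A x - w x = complex_of_real (indicator A x - f x)"
      by (simp add: w_def indicator_def)
    then have "cmod (indicator A x - w x) = \<bar>indicator A x - f x\<bar>" by (metis norm_of_real)
    also have "\<dots> \<le> 1" using f(2,3)[of x] by (auto simp: indicator_def)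
    finally show ?thesis using True by (simp add: power_le_one)
  next
    case False
    then have "indicator A x = w x" using f(4,5)[of x] K U by (auto simp: w_def indicator_def)
    then show ?thesis by simp
  qed
  have "l2sq (\<lambda>x. indicator A x - w x) \<le> (LINT x|\<mu>. indicator (U - K) x)"
    unfolding l2sq_def
  proof (rule integral_mono)
    show "integrable \<mu> (\<lambda>x. (cmod (indicator A x - w x))\<^sup>2)"
    proof (rule integrable_const_bound[where B = 1])
      have "norm ((cmod (indicator A x - w x))\<^sup>2) \<le> 1" for x
        using order_trans[OF le[of x] indicator_le_1] by simp
      then show "AE x in \<mu>. norm ((cmod (indicator A x - w x))\<^sup>2) \<le> 1" by simp
    qed (use assms continuous_measurable[OF w] in measurable)
    show "integrable \<mu> (indicator (U - K) :: _ \<Rightarrow> real)"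
      using U Ks by (simp add: less_top[symmetric] emeasure_finite)
  qed (rule le)
  also have "\<dots> = measure \<mu> U - measure \<mu> K"
    using U Ks K finite_measure_Diff[of U K] by simp
  also have "\<dots> < e" using U3 K by simp
  finally show "\<exists>w. continuous_on UNIV w \<and> l2sq (\<lambda>x. indicator A x - w x) < e" using w by blast
qed

lemma L2_indicator: "A \<in> sets borel \<Longrightarrow> indicator A \<in> L2"
  by (rule L2_bounded[OF L2_const[of 1], where B = 1]) (auto simp: indicator_def)

lemma approximable_sum:
  assumes "finite I" "\<And>i. i \<in> I \<Longrightarrow> u i \<in> L2" "\<And>i. i \<in> I \<Longrightarrow> approximable (u i)"
  shows "approximable (\<lambda>x. \<Sum>i\<in>I. u i x)"
  using assms
proof (induction I rule: finite_induct)
  case empty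
  show ?case by (auto simp: approximable_def l2sq_def intro!: exI[of _ "\<lambda>_. 0"])
next
  case (insert i I)
  then show ?case by (simp add: approximable_add L2_sum)
qed

lemma L2_approximable:
  assumes u: "u \<in> L2"
  shows "approximable u"
  unfolding approximable_def
proof (intro allI impI)
  fix e :: real assume e: "e > 0"
  note um [measurable] = L2_measurable[OF u]
  obtain s where s: "\<And>i. simple_function \<mu> (s i)" "\<And>x. (\<lambda>i. s i x) \<longlonglongrightarrow> u x" "\<And>i x. cmod (s i x) \<le> 2 * cmod (u x)"
    using borel_measurable_implies_sequence_metric[OF um, of 0] by (auto simp: dist_norm)
  have sm [measurable]: "s i \<in> borel_measurable \<mu>" for i by (rule borel_measurable_simple_function[OF s(1)])
  have sL: "s i \<in> L2" for i by (rule L2_bounded[OF u sm s(3)])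
  have ap: "approximable (s i)" for i
  proof -
    let ?g = "\<lambda>y x. y * indicator (s i -` {y}) x"
    have set: "s i -` {y} \<in> sets borel" for y
      using simple_functionD(2)[OF s(1), of i "{y}"] by simp
    have "s i = (\<lambda>x. \<Sum>y\<in>range (s i). ?g y x)"
    proof
      fix x
      show "s i x = (\<Sum>y\<in>range (s i). ?g y x)"
        by (rule trans[OF simple_function_indicator_representation_banach[OF s(1)]])
          (auto intro!: sum.cong simp: indicator_def)
    qed
    moreover have "approximable (\<lambda>x. \<Sum>y\<in>range (s i). ?g y x)"
      using simple_functionD(1)[OF s(1), of i] set
      by (intro approximable_sum approximable_cmult approximable_indicator L2_cmult L2_indicator) auto
    ultimately show ?thesis by simp
  qed
  have "(\<lambda>i. l2sq (\<lambda>x. u x - s i x)) \<longlonglongrightarrow> (LINT x|\<mu>. 0 :: real)"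
    unfolding l2sq_def
  proof (rule integral_dominated_convergence)
    show "integrable \<mu> (\<lambda>x. 9 * (cmod (u x))\<^sup>2)" using L2_integrable_sq[OF u] by simp
    have "(\<lambda>i. (cmod (u x - s i x))\<^sup>2) \<longlonglongrightarrow> (cmod (u x - u x))\<^sup>2" for x
      by (intro tendsto_intros s)
    then show "AE x in \<mu>. (\<lambda>i. (cmod (u x - s i x))\<^sup>2) \<longlonglongrightarrow> 0" by simp
    show "AE x in \<mu>. norm ((cmod (u x - s i x))\<^sup>2) \<le> 9 * (cmod (u x))\<^sup>2" for i
    proof (rule AE_I2)
      fix x
      have "cmod (u x - s i x) \<le> 3 * cmod (u x)"
        using norm_triangle_ineq4[of "u x" "s i x"] s(3)[of i x] by simp
      from power_mono[OF this norm_ge_zero, of 2]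
      show "norm ((cmod (u x - s i x))\<^sup>2) \<le> 9 * (cmod (u x))\<^sup>2" by (simp add: power_mult_distrib)
    qed
  qed measurable
  then have "(\<lambda>i. l2sq (\<lambda>x. u x - s i x)) \<longlonglongrightarrow> 0" by simp
  from order_tendstoD(2)[OF this, of "e / 4"] e obtain i where i: "l2sq (\<lambda>x. u x - s i x) < e / 4"
    by (auto simp: eventually_sequentially)
  obtain w where w: "continuous_on UNIV w" "l2sq (\<lambda>x. s i x - w x) < e / 4"
    using ap[of i] e unfolding approximable_def by (meson divide_pos_pos zero_less_numeral)
  have "l2sq (\<lambda>x. (u x - s i x) + (s i x - w x)) \<le> 2 * l2sq (\<lambda>x. u x - s i x) + 2 * l2sq (\<lambda>x. s i x - w x)"
    by (intro l2sq_add_le L2_diff u sL L2_continuous w)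
  also have "\<dots> < e" using i w by simp
  finally show "\<exists>w. continuous_on UNIV w \<and> l2sq (\<lambda>x. u x - w x) < e" using w by auto
qed

text \<open>A continuous approximation whose correlations with \<open>w\<close> are uniformly close, and whose mean is
  close.\<close>

lemma correlation_approx:
  assumes u: "u \<in> L2" and w: "w \<in> L2" and e: "e > 0"
  obtains v where "continuous_on UNIV v"
    "\<And>g. cmod ((LINT x|\<mu>. u (g + x) * w x) - (LINT x|\<mu>. v (g + x) * w x)) < e"
    "cmod ((LINT x|\<mu>. u x) - (LINT x|\<mu>. v x)) < e"
proof -
  \<comment> \<open>The summand 1 makes the estimate valid for the weight \<open>w\<close> and also for the constant weight 1.\<close>
  define t where "t = 2 * (l2sq w + 1) / e"
  have t: "t > 0" using e l2sq_nonneg[of w] by (simp add: t_def add_nonneg_pos)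
  have "e / (2 * t) > 0" using e t by simp
  then obtain v where v: "continuous_on UNIV v" "l2sq (\<lambda>x. u x - v x) < e / (2 * t)"
    using L2_approximable[OF u] unfolding approximable_def by meson
  have vL: "v \<in> L2" by (rule L2_continuous[OF v(1)])
  have close: "cmod ((LINT x|\<mu>. u (g + x) * z x) - (LINT x|\<mu>. v (g + x) * z x)) < e"
    if z: "z \<in> L2" "l2sq z \<le> l2sq w + 1" for g z
  proof -
    have "(LINT x|\<mu>. u (g + x) * z x) - (LINT x|\<mu>. v (g + x) * z x) = (LINT x|\<mu>. (u (g + x) - v (g + x)) * z x)"
      using L2_integrable_mult(1)[OF L2_translate[OF u] z(1)] L2_integrable_mult(1)[OF L2_translate[OF vL] z(1)]
      by (simp add: left_diff_distrib)
    also have "cmod \<dots> \<le> t * l2sq (\<lambda>x. u (g + x) - v (g + x)) + l2sq z / t"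
      by (intro L2_integrable_mult(2) t z L2_diff L2_translate u vL)
    also have "l2sq (\<lambda>x. u (g + x) - v (g + x)) = l2sq (\<lambda>x. u x - v x)"
      using l2sq_translate[OF L2_diff[OF u vL]] .
    also have "t * l2sq (\<lambda>x. u x - v x) + l2sq z / t < e"
    proof -
      have "t * l2sq (\<lambda>x. u x - v x) < e / 2" using v(2) t by (simp add: field_simps)
      moreover have "l2sq z / t \<le> e / 2"
      proof -
        have "l2sq z / t \<le> (l2sq w + 1) / t" using z t by (simp add: divide_right_mono)
        also have "\<dots> = e / 2" using e l2sq_nonneg[of w] by (simp add: t_def divide_simps)
        finally show ?thesis .
      qed
      ultimately show ?thesis by linarith
    qed
    finally show ?thesis .
  qed
  have "l2sq (\<lambda>_. 1) \<le> l2sq w + 1"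
    using l2sq_nonneg[of w] prob_space by (simp add: l2sq_def)
  from close[OF L2_const this, of 0] close[OF w] v(1) show ?thesis by (intro that) simp_all
qed

lemma continuous_correlation_L2:
  assumes u: "u \<in> L2" and w: "w \<in> L2"
  shows "continuous_on UNIV (\<lambda>g. LINT x|\<mu>. u (g + x) * w x)"
proof -
  have "\<exists>v. \<forall>n. continuous_on UNIV (v n) \<and> (\<forall>g. cmod ((LINT x|\<mu>. u (g + x) * w x) - (LINT x|\<mu>. v n (g + x) * w x)) < inverse (real (Suc n)))"
  proof (intro choice allI)
    fix n
    have "inverse (real (Suc n)) > 0" by simp
    from correlation_approx[OF u w this]
    show "\<exists>v. continuous_on UNIV v \<and> (\<forall>g. cmod ((LINT x|\<mu>. u (g + x) * w x) - (LINT x|\<mu>. v (g + x) * w x)) < inverse (real (Suc n)))"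
      by metis
  qed
  then obtain v where v: "\<And>n. continuous_on UNIV (v n)"
    "\<And>n g. cmod ((LINT x|\<mu>. u (g + x) * w x) - (LINT x|\<mu>. v n (g + x) * w x)) < inverse (real (Suc n))" by blast
  have "uniform_limit UNIV (\<lambda>n g. LINT x|\<mu>. v n (g + x) * w x) (\<lambda>g. LINT x|\<mu>. u (g + x) * w x) sequentially"
  proof (rule uniform_limitI)
    fix e :: real assume "e > 0"
    then obtain k where k: "inverse (real (Suc k)) < e" using reals_Archimedean by blast
    have "dist (LINT x|\<mu>. v n (g + x) * w x) (LINT x|\<mu>. u (g + x) * w x) < e" if "n \<ge> k" for n g
    proof -
      have "inverse (real (Suc n)) \<le> inverse (real (Suc k))" using that by simp
      then show ?thesis
        using order_less_le_trans[OF v(2)[of g n]] k by (simp only: dist_norm norm_minus_commute)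
    qed
    then show "\<forall>\<^sub>F n in sequentially. \<forall>g\<in>UNIV. dist (LINT x|\<mu>. v n (g + x) * w x) (LINT x|\<mu>. u (g + x) * w x) < e"
      by (auto simp: eventually_sequentially)
  qed
  from uniform_limit_theorem[OF _ this trivial_limit_sequentially] show ?thesis
    by (simp add: continuous_correlation v(1) L2_integrable[OF w])
qed

lemma mean_correlation_continuous:
  fixes u w :: "'a \<Rightarrow> 'b::{real_normed_field, banach, second_countable_topology}"
  assumes "continuous_on UNIV u" "integrable \<mu> w"
  shows "(LINT g|\<mu>. LINT x|\<mu>. u (g + x) * w x) = (LINT x|\<mu>. u x) * (LINT x|\<mu>. w x)"
proof -
  have "continuous_on UNIV (\<lambda>p :: 'a \<times> 'a. u (fst p + snd p))"
    by (rule continuous_on_compose2[OF assms(1)]) (auto intro!: continuous_intros)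
  from swap_continuous_kernel[OF compact_UNIV compact_UNIV this finite_haar sets_haar sets_haar assms(2)]
  have "(LINT g|\<mu>. LINT x|\<mu>. u (g + x) * w x) = (LINT x|\<mu>. (LINT g|\<mu>. u (g + x)) * w x)" by simp
  also have "(\<lambda>x. LINT g|\<mu>. u (g + x)) = (\<lambda>x. LINT g|\<mu>. u g)"
    using integral_translate[OF continuous_measurable[OF assms(1)]] by (simp add: add.commute)
  finally show ?thesis by (simp add: fun_eq_iff)
qed

lemma mean_correlation:
  assumes u: "u \<in> L2" and w: "w \<in> L2"
  shows "(LINT g|\<mu>. LINT x|\<mu>. u (g + x) * w x) = (LINT x|\<mu>. u x) * (LINT x|\<mu>. w x)"
proof -
  let ?W = "LINT x|\<mu>. w x"
  have "cmod ((LINT g|\<mu>. LINT x|\<mu>. u (g + x) * w x) - (LINT x|\<mu>. u x) * ?W) \<le> 0 + e" if e: "e > 0" for e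
  proof -
    define d where "d = e / (cmod ?W + 1)"
    have W: "cmod ?W + 1 > 0" by (simp add: add_nonneg_pos)
    then have d: "d > 0" using e by (simp add: d_def)
    obtain v where v: "continuous_on UNIV v" "\<And>g. cmod ((LINT x|\<mu>. u (g + x) * w x) - (LINT x|\<mu>. v (g + x) * w x)) < d"
      "cmod ((LINT x|\<mu>. u x) - (LINT x|\<mu>. v x)) < d"
      by (rule correlation_approx[OF u w d]) blast
    have iw: "integrable \<mu> w" by (rule L2_integrable[OF w])
    have iu: "integrable \<mu> (\<lambda>g. LINT x|\<mu>. u (g + x) * w x)"
      by (rule continuous_integrable[OF continuous_correlation_L2[OF u w]])
    have iv: "integrable \<mu> (\<lambda>g. LINT x|\<mu>. v (g + x) * w x)"
      by (rule continuous_integrable[OF continuous_correlation[OF v(1) iw]])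
    have "cmod ((LINT g|\<mu>. LINT x|\<mu>. u (g + x) * w x) - (LINT g|\<mu>. LINT x|\<mu>. v (g + x) * w x))
      = cmod (LINT g|\<mu>. (LINT x|\<mu>. u (g + x) * w x) - (LINT x|\<mu>. v (g + x) * w x))"
      by (simp only: Bochner_Integration.integral_diff[OF iu iv])
    also have "\<dots> \<le> (LINT g|\<mu>. d)"
      by (intro norm_integral_le Bochner_Integration.integrable_diff iu iv less_imp_le[OF v(2)]) simp
    also have "\<dots> = d" using prob_space by simp
    finally have 1: "cmod ((LINT g|\<mu>. LINT x|\<mu>. u (g + x) * w x) - (LINT x|\<mu>. v x) * ?W) \<le> d"
      by (simp only: mean_correlation_continuous[OF v(1) iw])
    have 2: "cmod ((LINT x|\<mu>. v x) * ?W - (LINT x|\<mu>. u x) * ?W) \<le> d * cmod ?W"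
      using v(3) by (simp add: left_diff_distrib[symmetric] norm_mult norm_minus_commute mult_right_mono)
    have "d + d * cmod ?W = e" using W by (simp add: d_def divide_simps) (simp add: algebra_simps)
    with norm_triangle_le[OF add_mono[OF 1 2]] show ?thesis by simp
  qed
  then have "cmod ((LINT g|\<mu>. LINT x|\<mu>. u (g + x) * w x) - (LINT x|\<mu>. u x) * ?W) \<le> 0"
    by (rule field_le_epsilon)
  then show ?thesis by simp
qed

end

section \<open>Divisibility of compact connected groups\<close>

context haar_measure begin

lemma integral_continuous_pos:
  fixes u :: "'a \<Rightarrow> real"
  assumes "continuous_on UNIV u" "\<And>x. 0 \<le> u x" "0 < u x"
  shows "0 < (LINT x|\<mu>. u x)"
proof -
  define U where "U = u -` {u x / 2 <..}"
  have U: "open U" unfolding U_def by (intro open_vimage assms) simp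
  have "x \<in> U" using assms(3) by (simp add: U_def)
  then have "0 < (u x / 2) * measure \<mu> U" using open_measure_pos[OF U] assms(3) by simp
  also have "\<dots> = (LINT y|\<mu>. (u x / 2) * indicator U y)" by simp
  also have "\<dots> \<le> (LINT y|\<mu>. u y)"
  proof (rule integral_mono)
    show "integrable \<mu> (\<lambda>y. (u x / 2) * indicator U y)"
      using U by (simp add: less_top[symmetric] emeasure_finite)
    show "(u x / 2) * indicator U y \<le> u y" for y
      using assms(2)[of y] by (auto simp: U_def indicator_def)
  qed (rule continuous_integrable[OF assms(1)])
  finally show ?thesis .
qed

text \<open>For a function \<open>u\<close> that is invariant under \<open>j g\<close>, the average of \<open>u\<close> over its translates by
  \<open>0, g, \<dots>, (j - 1) g\<close> is invariant under \<open>g\<close>. The average and its difference from \<open>u\<close> are orthogonal for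
  every translation invariant symmetric bilinear form \<open>\<Phi>\<close>.\<close>

lemma cyclic_average_invariant:
  fixes u :: "'a \<Rightarrow> real"
  assumes "\<And>x. u (nat_multiple j g + x) = u x"
  shows "(\<Sum>i<j. u (nat_multiple i g + (nat_multiple k g + x))) = (\<Sum>i<j. u (nat_multiple i g + x))"
proof (induction k arbitrary: x)
  case (Suc k)
  have 1: "(\<Sum>i<j. u (nat_multiple i g + (g + x))) = (\<Sum>i<j. u (nat_multiple i g + x))" for x
  proof -
    let ?f = "\<lambda>i. u (nat_multiple i g + x)"
    have "(\<Sum>i<j. u (nat_multiple i g + (g + x))) = (\<Sum>i<j. ?f (Suc i))"
      by (simp add: ac_simps)
    moreover have "?f 0 + (\<Sum>i<j. ?f (Suc i)) = (\<Sum>i<j. ?f i) + ?f j"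
      using sum.lessThan_Suc_shift[of ?f j] by simp
    moreover have "?f j = ?f 0" using assms by simp
    ultimately show ?thesis by linarith
  qed
  have "(\<Sum>i<j. u (nat_multiple i g + (nat_multiple (Suc k) g + x)))
      = (\<Sum>i<j. u (nat_multiple i g + (nat_multiple k g + (g + x))))"
    by (simp add: ac_simps)
  also have "\<dots> = (\<Sum>i<j. u (nat_multiple i g + x))" using Suc 1 by simp
  finally show ?case .
qed simp

lemma cyclic_average_orthogonal:
  fixes \<Phi> :: "('a \<Rightarrow> real) \<Rightarrow> ('a \<Rightarrow> real) \<Rightarrow> real"
  assumes add: "\<And>a b c. continuous_on UNIV a \<Longrightarrow> continuous_on UNIV b \<Longrightarrow> continuous_on UNIV c \<Longrightarrow>
      \<Phi> (\<lambda>x. a x + b x) c = \<Phi> a c + \<Phi> b c"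
    and scale: "\<And>r a c. continuous_on UNIV a \<Longrightarrow> continuous_on UNIV c \<Longrightarrow> \<Phi> (\<lambda>x. r * a x) c = r * \<Phi> a c"
    and sym: "\<And>a c. \<Phi> a c = \<Phi> c a"
    and inv: "\<And>h a c. continuous_on UNIV a \<Longrightarrow> continuous_on UNIV c \<Longrightarrow> \<Phi> (\<lambda>x. a (h + x)) (\<lambda>x. c (h + x)) = \<Phi> a c"
    and u: "continuous_on UNIV u" and per: "\<And>x. u (nat_multiple j g + x) = u x" and j: "j > 0"
    and P: "\<And>x. P x = (\<Sum>i<j. u (nat_multiple i g + x)) / real j"
  shows "\<Phi> u u = \<Phi> P P + \<Phi> (\<lambda>x. u x - P x) (\<lambda>x. u x - P x)"
proof -
  have ui: "continuous_on UNIV (\<lambda>x. u (h + x))" for h by (rule continuous_translate[OF u])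
  have P': "P = (\<lambda>x. inverse (real j) * (\<Sum>i<j. u (nat_multiple i g + x)))"
    using P by (auto simp: divide_inverse mult.commute)
  have cP: "continuous_on UNIV P"
    unfolding P' by (intro continuous_intros ui)
  have PP: "P (nat_multiple k g + x) = P x" for k x
    using cyclic_average_invariant[of u j g, OF per] by (simp add: P)
  have sum: "\<Phi> (\<lambda>x. \<Sum>i<k. u (nat_multiple i g + x)) P = real k * \<Phi> u P" for k
  proof (induction k)
    case 0
    show ?case using scale[OF u cP, of 0] by simp
  next
    case (Suc k)
    have "\<Phi> (\<lambda>x. u (nat_multiple k g + x)) P = \<Phi> u P"
      using inv[OF u cP, of "nat_multiple k g"] by (simp add: PP)
    then show ?case
      using Suc add[of "\<lambda>x. \<Sum>i<k. u (nat_multiple i g + x)" "\<lambda>x. u (nat_multiple k g + x)" P] ui cP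
      by (simp add: continuous_on_sum distrib_right)
  qed
  have "\<Phi> P P = inverse (real j) * \<Phi> (\<lambda>x. \<Sum>i<j. u (nat_multiple i g + x)) P"
    by (subst (1) P') (intro scale cP continuous_on_sum ui)
  then have PuP: "\<Phi> P P = \<Phi> u P" using sum[of j] j by simp
  have nP: "continuous_on UNIV (\<lambda>x. - 1 * P x)" by (intro continuous_intros cP)
  define y where "y x = u x - P x" for x
  have y': "y = (\<lambda>x. u x + - 1 * P x)" by (simp add: y_def fun_eq_iff)
  have cy: "continuous_on UNIV y" unfolding y' by (intro continuous_intros cP u)
  have yl: "\<Phi> y c = \<Phi> u c - \<Phi> P c" if "continuous_on UNIV c" for c
    unfolding y' using add[OF u nP that] scale[OF cP that, of "- 1"] by simp
  have "\<Phi> y y = \<Phi> y u - \<Phi> y P"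
    using yl[OF cy] sym[of u y] sym[of P y] by simp
  also have "\<dots> = \<Phi> u u - \<Phi> P u - (\<Phi> u P - \<Phi> P P)" using yl[OF u] yl[OF cP] by simp
  also have "\<dots> = \<Phi> u u - \<Phi> P P" using PuP sym[of P u] by simp
  finally show ?thesis unfolding y_def by simp
qed

text \<open>The inner product of real functions in \<open>L^2\<close>.\<close>

abbreviation inner_real :: "('a \<Rightarrow> real) \<Rightarrow> ('a \<Rightarrow> real) \<Rightarrow> real" where
  "inner_real a b \<equiv> (LINT x|\<mu>. a x * b x)"

lemma inner_real_translate:
  assumes "continuous_on UNIV a" "continuous_on UNIV b"
  shows "inner_real (\<lambda>x. a (h + x)) (\<lambda>x. b (h + x)) = inner_real a b"
  using integral_translate[of "\<lambda>x. a x * b x" h] assms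
  by (simp add: continuous_measurable continuous_on_mult)

lemma inner_real_add:
  assumes "continuous_on UNIV a" "continuous_on UNIV b" "continuous_on UNIV c"
  shows "inner_real (\<lambda>x. a x + b x) c = inner_real a c + inner_real b c"
  using assms by (simp add: distrib_right continuous_integrable continuous_on_mult)

lemma inner_real_nonneg: "inner_real a a \<ge> 0"
  by simp

lemma inner_real_add_le:
  assumes "continuous_on UNIV a" "continuous_on UNIV b"
  shows "inner_real (\<lambda>x. a x + b x) (\<lambda>x. a x + b x) \<le> 2 * inner_real a a + 2 * inner_real b b"
proof -
  have "inner_real (\<lambda>x. a x + b x) (\<lambda>x. a x + b x) \<le> (LINT x|\<mu>. 2 * (a x * a x) + 2 * (b x * b x))"
  proof (rule integral_mono)
    show "(a x + b x) * (a x + b x) \<le> 2 * (a x * a x) + 2 * (b x * b x)" for x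
      using sum_squares_bound[of "a x" "b x"] by (simp add: algebra_simps power2_eq_square)
  qed (intro continuous_integrable continuous_intros assms)+
  also have "\<dots> = 2 * inner_real a a + 2 * inner_real b b"
    using assms by (simp add: continuous_integrable continuous_on_mult)
  finally show ?thesis .
qed

lemma integral_abs_sq_le:
  fixes u :: "'a \<Rightarrow> real"
  assumes "continuous_on UNIV u"
  shows "(LINT x|\<mu>. \<bar>u x\<bar>)\<^sup>2 \<le> inner_real u u"
proof -
  define m where "m = (LINT x|\<mu>. \<bar>u x\<bar>)"
  have i: "integrable \<mu> (\<lambda>x. \<bar>u x\<bar>)" "integrable \<mu> (\<lambda>x. u x * u x)"
    by (intro continuous_integrable continuous_intros assms)+
  have "0 \<le> (LINT x|\<mu>. (\<bar>u x\<bar> - m)\<^sup>2)" by simp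
  also have "(\<lambda>x. (\<bar>u x\<bar> - m)\<^sup>2) = (\<lambda>x. u x * u x - 2 * m * \<bar>u x\<bar> + m\<^sup>2)"
    by (simp add: fun_eq_iff power2_diff) (simp add: power2_eq_square)
  also have "(LINT x|\<mu>. u x * u x - 2 * m * \<bar>u x\<bar> + m\<^sup>2) = inner_real u u - 2 * m * m + m\<^sup>2"
    using i prob_space by (simp add: m_def)
  finally show ?thesis unfolding m_def[symmetric] by (simp add: power2_eq_square)
qed

text \<open>A continuous function \<open>v\<close> of mean 0 that is invariant under all elements \<open>j h\<close> vanishes. Otherwise
  let \<open>E\<close> be the space of all such functions and \<open>c u\<close> the correlation of \<open>v\<close> with \<open>u\<close>, and let \<open>\<rho> > 0\<close>
  be the supremum of the form \<open>B u u = \<parallel>c u\<parallel>^2\<close> over the unit sphere of \<open>E\<close>. For \<open>g\<close> in a suitable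
  neighbourhood \<open>N\<close> of 0, split \<open>u\<close> into its average \<open>P\<close> over the multiples of \<open>g\<close> and the rest \<open>y\<close>. As the
  translates of \<open>y\<close> by \<open>0, g, \<dots>, (j - 1) g\<close> sum to 0 and \<open>c\<close> hardly sees a translation by an element of
  \<open>N0\<close>, one gets \<open>B y y \<le> \<rho>/2 \<parallel>y\<parallel>^2\<close>. So if \<open>u\<close> almost attains the supremum, then \<open>y\<close> is small, and \<open>u\<close>
  is almost invariant under \<open>g\<close>. The neighbourhood does not depend on how close \<open>u\<close> is to attaining
  it, and boundedly many elements of \<open>N\<close> sum to any given element, so \<open>u\<close> is almost
  invariant under the whole group, which is impossible for a unit vector of mean 0.\<close>

lemma periodic_continuous_eq_zero:
  fixes v :: "'a \<Rightarrow> real"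
  assumes conn: "connected (UNIV :: 'a set)" and j: "j > 0"
    and v: "continuous_on UNIV v" and per: "\<And>h x. v (nat_multiple j h + x) = v x"
    and mean: "(LINT x|\<mu>. v x) = 0"
  shows "v x = 0"
proof (rule ccontr)
  assume vx: "v x \<noteq> 0"
  define c where "c u x = (LINT y|\<mu>. v (x + y) * u y)" for u x
  define B where "B a b = (LINT x|\<mu>. c a x * c b x)" for a b
  define E where "E u \<longleftrightarrow> continuous_on UNIV u \<and> (\<forall>h x. u (nat_multiple j h + x) = u x) \<and> (LINT x|\<mu>. u x) = 0"
    for u :: "'a \<Rightarrow> real"
  note cint = continuous_integrable
  obtain M where M: "M > 0" "\<And>x. norm (v x) \<le> M"
    using continuous_compact_bounded[OF compact_UNIV v] by metis
  have vt: "continuous_on UNIV (\<lambda>y. v (x + y))" for x by (rule continuous_translate[OF v])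
  have ci: "integrable \<mu> (\<lambda>y. v (x + y) * u y)" if "continuous_on UNIV u" for u x
    by (intro cint continuous_on_mult vt that)
  have c_cont: "continuous_on UNIV (c u)" if "continuous_on UNIV u" for u
    unfolding c_def by (rule continuous_correlation[OF v cint[OF that]])
  have c_add: "c (\<lambda>x. a x + b x) x = c a x + c b x" if "continuous_on UNIV a" "continuous_on UNIV b" for a b x
    unfolding c_def using ci[OF that(1)] ci[OF that(2)] by (simp add: distrib_left)
  have c_scale: "c (\<lambda>x. r * a x) x = r * c a x" for r a x
  proof -
    have "(\<lambda>y. v (x + y) * (r * a y)) = (\<lambda>y. r * (v (x + y) * a y))" by (simp add: fun_eq_iff)
    then show ?thesis unfolding c_def by simp
  qed
  have c_translate: "c (\<lambda>x. u (g + x)) x = c u (- g + x)" if "continuous_on UNIV u" for u g x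
  proof -
    have "(\<lambda>y. v ((- g + x) + y) * u y) \<in> borel_measurable \<mu>"
      by (intro continuous_measurable continuous_on_mult vt that)
    from integral_translate[OF this, of g] show ?thesis
      unfolding c_def by (simp add: algebra_simps)
  qed
  have c_bound: "\<bar>c u x\<bar> \<le> M * (LINT y|\<mu>. \<bar>u y\<bar>)" if "continuous_on UNIV u" for u x
  proof -
    have "norm (c u x) \<le> (LINT y|\<mu>. M * \<bar>u y\<bar>)"
      unfolding c_def using M(2)
      by (intro norm_integral_le ci that cint continuous_intros) (auto simp: abs_mult intro!: mult_right_mono)
    then show ?thesis by simp
  qed
  have B_int: "integrable \<mu> (\<lambda>x. c a x * c b x)" if "continuous_on UNIV a" "continuous_on UNIV b" for a b
    by (intro cint continuous_on_mult c_cont that)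
  have B_add: "B (\<lambda>x. a x + b x) d = B a d + B b d"
    if "continuous_on UNIV a" "continuous_on UNIV b" "continuous_on UNIV d" for a b d
    unfolding B_def using c_add[OF that(1,2)] B_int that by (simp add: distrib_right)
  have B_scale: "B (\<lambda>x. r * a x) d = r * B a d" for r a d
    unfolding B_def c_scale by (simp add: mult.assoc)
  have B_sym: "B a d = B d a" for a d by (simp add: B_def mult.commute)
  have B_translate: "B (\<lambda>x. a (h + x)) (\<lambda>x. d (h + x)) = B a d"
    if "continuous_on UNIV a" "continuous_on UNIV d" for h a d
    unfolding B_def c_translate[OF that(1)] c_translate[OF that(2)]
    by (rule integral_translate[of "\<lambda>x. c a x * c d x"])
      (intro continuous_measurable continuous_on_mult c_cont that)
  have B_le: "B u u \<le> b * M * inner_real u u"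
    if u: "continuous_on UNIV u" and b: "b \<ge> 0" "\<And>x. \<bar>c u x\<bar> \<le> b * (LINT y|\<mu>. \<bar>u y\<bar>)" for u b
  proof -
    let ?m = "LINT y|\<mu>. \<bar>u y\<bar>"
    have "B u u \<le> (LINT x|\<mu>. (b * ?m) * (M * ?m))"
      unfolding B_def
    proof (rule integral_mono[OF B_int[OF u u]])
      fix x
      have "c u x * c u x = \<bar>c u x\<bar> * \<bar>c u x\<bar>" by simp
      also have "\<dots> \<le> (b * ?m) * (M * ?m)"
        using b c_bound[OF u] by (intro mult_mono) (auto intro!: mult_nonneg_nonneg)
      finally show "c u x * c u x \<le> (b * ?m) * (M * ?m)" .
    qed simp
    also have "\<dots> = b * M * ?m\<^sup>2" using prob_space by (simp add: power2_eq_square)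
    also have "\<dots> \<le> b * M * inner_real u u"
      using b M by (intro mult_left_mono integral_abs_sq_le u) simp
    finally show ?thesis .
  qed
  have Ev: "E v" using v per mean by (simp add: E_def)
  have vv: "inner_real v v > 0"
    by (rule integral_continuous_pos[where x = x])
      (use vx v in \<open>auto intro: continuous_on_mult simp: zero_less_mult_iff\<close>)
  have Bvv: "B v v > 0"
    unfolding B_def
  proof (rule integral_continuous_pos[where x = 0])
    show "0 < c v 0 * c v 0" using vv by (simp add: c_def)
  qed (auto intro: continuous_on_mult c_cont[OF v])
  define R where "R = {B u u | u. E u \<and> inner_real u u = 1}"
  define \<rho> where "\<rho> = Sup R"
  have R_normalise: "B u u / inner_real u u \<in> R" if u: "E u" "inner_real u u > 0" for u
  proof -
    define r where "r = 1 / sqrt (inner_real u u)"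
    have r2: "r * r = 1 / inner_real u u"
      using u(2) by (simp add: r_def)
    have "E (\<lambda>x. r * u x)" using u(1) by (auto simp: E_def intro!: continuous_intros)
    moreover have "(\<lambda>x. r * u x * (r * u x)) = (\<lambda>x. (r * r) * (u x * u x))" by (simp add: fun_eq_iff)
    then have "inner_real (\<lambda>x. r * u x) (\<lambda>x. r * u x) = 1" using r2 u(2) by simp
    moreover have "B (\<lambda>x. r * u x) (\<lambda>x. r * u x) = B u u / inner_real u u"
      using B_scale[of r u "\<lambda>x. r * u x"] B_scale[of r u u] B_sym[of u "\<lambda>x. r * u x"] r2
      by (simp add: mult.assoc[symmetric])
    ultimately show ?thesis unfolding R_def by force
  qed
  have R_bdd: "bdd_above R"
  proof (rule bdd_aboveI)
    fix b assume "b \<in> R"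
    then obtain u where u: "E u" "inner_real u u = 1" "b = B u u" by (auto simp: R_def)
    then show "b \<le> M * M"
      using B_le[of u M] c_bound[of u] M by (simp add: E_def)
  qed
  have \<rho>: "\<rho> > 0"
    using cSup_upper[OF R_normalise[OF Ev vv] R_bdd] Bvv vv unfolding \<rho>_def
    by (meson divide_pos_pos less_le_trans)
  have B_le_\<rho>: "B u u \<le> \<rho> * inner_real u u" if u: "E u" for u
  proof (cases "inner_real u u = 0")
    case True
    then show ?thesis using B_le[of u M] c_bound[of u] M u by (simp add: E_def)
  next
    case False
    then have pos: "inner_real u u > 0" using inner_real_nonneg[of u] by linarith
    from cSup_upper[OF R_normalise[OF u this] R_bdd] show ?thesis
      unfolding \<rho>_def using pos by (simp add: field_simps)
  qed
  define \<eta> where "\<eta> = \<rho> / (2 * M)"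
  have \<eta>: "\<eta> > 0" "\<eta> * M = \<rho> / 2" using \<rho> M by (simp_all add: \<eta>_def)
  obtain N0 where N0: "open N0" "0 \<in> N0" "\<And>g x. g \<in> N0 \<Longrightarrow> dist (v (g + x)) (v x) \<le> \<eta>"
    using dist_translate_le[OF compact_UNIV v \<eta>(1)] by metis
  define N where "N = (\<Inter>i<j. (\<lambda>g. nat_multiple i g) -` N0)"
  have N: "open N" "0 \<in> N"
    unfolding N_def using N0 by (auto intro!: open_INT open_vimage continuous_intros)
  obtain r where r: "sumset_power r N = UNIV"
    using sumset_power_eq_UNIV[OF compact_UNIV conn N] by metis
  \<comment> \<open>A displacement is at most \<open>8 \<delta>\<close> on \<open>N\<close>, and each further summand costs a factor of at most 4.\<close>
  define \<delta> where "\<delta> = 1 / (8 * 4 ^ r :: real)"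
  have \<delta>: "\<delta> > 0" "8 * \<delta> * 4 ^ r = 1" by (simp_all add: \<delta>_def)
  have "(1 - \<delta>) * \<rho> < Sup R" using \<rho> \<delta>(1) unfolding \<rho>_def[symmetric] by (simp add: algebra_simps)
  moreover have "R \<noteq> {}" using R_normalise[OF Ev vv] by blast
  ultimately obtain b where "b \<in> R" "(1 - \<delta>) * \<rho> < b"
    using less_cSup_iff[OF _ R_bdd] by blast
  then obtain u where u: "E u" "inner_real u u = 1" "(1 - \<delta>) * \<rho> < B u u" by (auto simp: R_def)
  have uc: "continuous_on UNIV u" and uper: "\<And>h x. u (nat_multiple j h + x) = u x"
    and umean: "(LINT x|\<mu>. u x) = 0" using u(1) by (auto simp: E_def)
  have ut: "continuous_on UNIV (\<lambda>x. u (g + x))" for g by (rule continuous_translate[OF uc])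
  define D where "D g = inner_real (\<lambda>x. u (g + x) - u x) (\<lambda>x. u (g + x) - u x)" for g
  have D_N: "D g \<le> 8 * \<delta>" if g: "g \<in> N" for g
  proof -
    define P where "P x = (\<Sum>i<j. u (nat_multiple i g + x)) / real j" for x
    define y where "y x = u x - P x" for x
    have P_cont: "continuous_on UNIV P"
      unfolding P_def divide_inverse by (intro continuous_intros ut)
    have y_cont: "continuous_on UNIV y"
      unfolding y_def by (intro continuous_intros uc P_cont)
    have yt: "continuous_on UNIV (\<lambda>x. y (h + x))" for h by (rule continuous_translate[OF y_cont])
    have P_inv: "P (nat_multiple k g + x) = P x" for k x
      unfolding P_def using cyclic_average_invariant[of u j g, OF uper] by simp
    have "u (nat_multiple i g + (nat_multiple j h + x)) = u (nat_multiple i g + x)" for i h x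
      using uper[of h "nat_multiple i g + x"] by (simp add: ac_simps)
    then have P_per: "P (nat_multiple j h + x) = P x" for h x by (simp add: P_def)
    have "(LINT x|\<mu>. P x) = (\<Sum>i<j. LINT x|\<mu>. u (nat_multiple i g + x)) / real j"
      unfolding P_def using cint[OF ut] by simp
    also have "\<dots> = 0"
      using integral_translate[OF continuous_measurable[OF uc]] umean by simp
    finally have EP: "E P" using P_cont P_per by (simp add: E_def)
    have y_sum: "(\<Sum>i<j. y (nat_multiple i g + x)) = 0" for x
      using j by (simp add: y_def sum_subtractf P_inv) (simp add: P_def)
    have c_y: "\<bar>c y x\<bar> \<le> \<eta> * (LINT z|\<mu>. \<bar>y z\<bar>)" for x
    proof -
      let ?m = "LINT z|\<mu>. \<bar>y z\<bar>"
      have diff: "\<bar>c y x - c y (- nat_multiple i g + x)\<bar> \<le> \<eta> * ?m" if "i < j" for i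
      proof -
        let ?h = "nat_multiple i g"
        have "?h \<in> N0" using g that by (simp add: N_def)
        then have le: "\<bar>v (x + z) - v (- ?h + x + z)\<bar> \<le> \<eta>" for z
          using N0(3)[of ?h "- ?h + x + z"] by (simp add: dist_real_def algebra_simps)
        have "c y x - c y (- ?h + x) = (LINT z|\<mu>. (v (x + z) - v (- ?h + x + z)) * y z)"
          unfolding c_def using ci[OF y_cont] by (simp add: left_diff_distrib)
        also have "\<bar>\<dots>\<bar> \<le> (LINT z|\<mu>. \<eta> * \<bar>y z\<bar>)"
          unfolding real_norm_def[symmetric] using le
          by (intro norm_integral_le cint continuous_intros vt y_cont) (auto simp: abs_mult intro!: mult_right_mono)
        finally show ?thesis by simp
      qed
      have "c (\<lambda>x. \<Sum>i<k. y (nat_multiple i g + x)) x = (\<Sum>i<k. c y (- nat_multiple i g + x))" for k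
      proof (induction k)
        case 0
        show ?case by (simp add: c_def)
      next
        case (Suc k)
        then show ?case
          using c_add[of "\<lambda>x. \<Sum>i<k. y (nat_multiple i g + x)" "\<lambda>x. y (nat_multiple k g + x)" x]
            c_translate[OF y_cont] yt by (simp add: continuous_on_sum)
      qed
      from this[of j] have "(\<Sum>i<j. c y (- nat_multiple i g + x)) = 0"
        by (simp add: y_sum) (simp add: c_def)
      then have "real j * c y x = (\<Sum>i<j. c y x - c y (- nat_multiple i g + x))"
        by (simp add: sum_subtractf)
      also have "\<bar>\<dots>\<bar> \<le> (\<Sum>i<j. \<eta> * ?m)"
        using diff by (intro order_trans[OF sum_abs] sum_mono) simp
      finally have "real j * \<bar>c y x\<bar> \<le> real j * (\<eta> * ?m)" by (simp add: abs_mult)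
      then show ?thesis using j by simp
    qed
    have By: "B y y \<le> \<rho> / 2 * inner_real y y"
      using B_le[OF y_cont less_imp_le[OF \<eta>(1)] c_y] \<eta>(2) by simp
    have "B u u = B P P + B y y"
      unfolding y_def
      by (rule cyclic_average_orthogonal[of B, OF B_add B_scale B_sym B_translate uc uper j P_def])
    moreover have uu: "inner_real u u = inner_real P P + inner_real y y"
      unfolding y_def
      by (rule cyclic_average_orthogonal[of inner_real, OF inner_real_add _ _ inner_real_translate uc uper j P_def])
        (auto simp: mult.commute mult.left_commute)
    ultimately have "B u u \<le> \<rho> * inner_real P P + \<rho> / 2 * inner_real y y"
      using B_le_\<rho>[OF EP] By by simp
    also have "\<dots> = \<rho> - \<rho> / 2 * inner_real y y"
    proof -
      have PP: "inner_real P P = 1 - inner_real y y" using uu u(2) by simp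
      show ?thesis unfolding PP by (simp add: algebra_simps)
    qed
    finally have "\<rho> * (inner_real y y / 2) \<le> \<rho> * \<delta>" using u(3) by (simp add: algebra_simps)
    then have yy: "inner_real y y \<le> 2 * \<delta>" using \<rho> by simp
    have "u (g + x) - u x = y (g + x) + - 1 * y x" for x
      using P_inv[of "Suc 0" x] by (simp add: y_def)
    then have "D g = inner_real (\<lambda>x. y (g + x) + - 1 * y x) (\<lambda>x. y (g + x) + - 1 * y x)"
      by (simp add: D_def)
    also have "\<dots> \<le> 2 * inner_real (\<lambda>x. y (g + x)) (\<lambda>x. y (g + x)) + 2 * inner_real (\<lambda>x. - 1 * y x) (\<lambda>x. - 1 * y x)"
      by (rule inner_real_add_le) (intro continuous_intros yt y_cont)+
    also have "\<dots> = 4 * inner_real y y"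
      using inner_real_translate[OF y_cont y_cont] by simp
    finally show ?thesis using yy by simp
  qed
  have D_add: "D (g + h) \<le> 2 * D g + 2 * D h" for g h
  proof -
    have e: "u (g + h + x) - u x = (u (h + (g + x)) - u (g + x)) + (u (g + x) - u x)" for x
      by (simp add: ac_simps)
    have cd: "continuous_on UNIV (\<lambda>x. u (k + x) - u x)" for k by (intro continuous_intros ut uc)
    have "D (g + h) \<le> 2 * inner_real (\<lambda>x. u (h + (g + x)) - u (g + x)) (\<lambda>x. u (h + (g + x)) - u (g + x)) + 2 * D g"
      unfolding D_def e by (intro inner_real_add_le cd continuous_translate[OF cd])
    also have "inner_real (\<lambda>x. u (h + (g + x)) - u (g + x)) (\<lambda>x. u (h + (g + x)) - u (g + x)) = D h"
      unfolding D_def by (rule inner_real_translate[OF cd cd])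
    finally show ?thesis by simp
  qed
  have D_sumset: "D g \<le> 8 * \<delta> * 4 ^ k" if "g \<in> sumset_power k N" for g k
    using that
  proof (induction k arbitrary: g)
    case 0
    then show ?case using D_N by simp
  next
    case (Suc k)
    then obtain a b where ab: "g = a + b" "a \<in> N" "b \<in> sumset_power k N" by auto
    have "D g \<le> 2 * D a + 2 * D b" using D_add ab by simp
    also have "\<dots> \<le> 2 * (8 * \<delta> * 4 ^ k) + 2 * (8 * \<delta> * 4 ^ k)"
    proof -
      have "8 * \<delta> * 1 \<le> 8 * \<delta> * 4 ^ k" using \<delta>(1) by (intro mult_left_mono) auto
      then show ?thesis using D_N[OF ab(2)] Suc.IH[OF ab(3)] by linarith
    qed
    finally show ?case by simp
  qed
  have "inner_real (\<lambda>x. u (g + x)) u \<ge> 1 / 2" for g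
  proof -
    have "D g = inner_real (\<lambda>x. u (g + x)) (\<lambda>x. u (g + x)) - 2 * inner_real (\<lambda>x. u (g + x)) u + inner_real u u"
    proof -
      have "(\<lambda>x. (u (g + x) - u x) * (u (g + x) - u x))
        = (\<lambda>x. u (g + x) * u (g + x) - 2 * (u (g + x) * u x) + u x * u x)"
        by (simp add: fun_eq_iff algebra_simps)
      moreover have "integrable \<mu> (\<lambda>x. u (g + x) * u (g + x))" "integrable \<mu> (\<lambda>x. u (g + x) * u x)"
        "integrable \<mu> (\<lambda>x. u x * u x)"
        by (intro cint continuous_on_mult ut uc)+
      ultimately show ?thesis unfolding D_def by simp
    qed
    also have "\<dots> = 2 - 2 * inner_real (\<lambda>x. u (g + x)) u"
      using inner_real_translate[OF uc uc, of g] u(2) by simp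
    finally show ?thesis using D_sumset[of g r] r \<delta>(2) by simp
  qed
  then have "(LINT g|\<mu>. 1 / 2) \<le> (LINT g|\<mu>. inner_real (\<lambda>x. u (g + x)) u)"
    by (intro integral_mono cint continuous_correlation[OF uc cint[OF uc]]) simp_all
  also have "\<dots> = 0" using mean_correlation_continuous[OF uc cint[OF uc]] umean by simp
  finally show False using prob_space by simp
qed

text \<open>A compact connected group is divisible: if \<open>x\<close> were not in the closed subgroup \<open>H\<close> of the elements
  \<open>j h\<close>, then averaging a Urysohn function over \<open>H\<close> would give an invariant function that separates 0
  and \<open>x\<close>.\<close>

lemma nat_multiple_surj:
  assumes conn: "connected (UNIV :: 'a set)" and j: "j > 0"
  shows "\<exists>y. nat_multiple j y = (x :: 'a)"
proof (rule ccontr)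
  assume x: "\<not> (\<exists>y. nat_multiple j y = x)"
  let ?H = "range (\<lambda>y :: 'a. nat_multiple j y)"
  have cH: "compact ?H"
    by (intro compact_continuous_image continuous_intros compact_UNIV)
  have cxH: "compact ((+) x ` ?H)"
    by (intro compact_continuous_image continuous_intros cH)
  have disj: "?H \<inter> (+) x ` ?H = {}"
  proof (rule ccontr)
    assume "?H \<inter> (+) x ` ?H \<noteq> {}"
    then obtain y z where yz: "nat_multiple j y = x + nat_multiple j z" by auto
    have "nat_multiple j (y - z) + nat_multiple j z = nat_multiple j y"
      by (subst nat_multiple_distrib[symmetric]) simp
    then have "nat_multiple j (y - z) = x" using yz by simp
    with x show False by blast
  qed
  obtain w :: "'a \<Rightarrow> real" where w: "continuous_on UNIV w" "\<And>y. y \<in> ?H \<Longrightarrow> w y = 0" "\<And>y. y \<in> (+) x ` ?H \<Longrightarrow> w y = 1"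
  proof (rule Urysohn_compact_T2[OF compact_UNIV, of ?H "(+) x ` ?H"])
    show "closed ?H" "closed ((+) x ` ?H)" "?H \<inter> (+) x ` ?H = {}"
      using cH cxH disj by (auto intro: compact_imp_closed)
  qed blast
  define v0 where "v0 y = (LINT h|\<mu>. w (nat_multiple j h + y))" for y
  have Fc: "continuous_on UNIV (\<lambda>p :: 'a \<times> 'a. w (nat_multiple j (snd p) + fst p))"
    by (rule continuous_on_compose2[OF w(1)]) (auto intro!: continuous_intros)
  have v0c: "continuous_on UNIV v0"
    using continuous_integral_kernel(2)[OF compact_UNIV compact_UNIV Fc sets_haar, of "\<lambda>_. 1"]
    by (simp add: v0_def)
  have v0_0: "v0 0 = 0" by (simp add: v0_def w(2))
  have v0_x: "v0 x = 1"
    using prob_space by (simp add: v0_def add.commute[of _ x] w(3))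
  have wm: "(\<lambda>h. w (nat_multiple j h + y)) \<in> borel_measurable \<mu>" for y
    by (intro continuous_measurable continuous_on_compose2[OF w(1)] continuous_intros) auto
  have per: "v0 (nat_multiple j k + y) = v0 y" for k y
    using integral_translate[OF wm, of k y] unfolding v0_def by (simp add: nat_multiple_distrib ac_simps)
  define m where "m = (LINT y|\<mu>. v0 y)"
  have "v0 y - m = 0" for y
  proof (rule periodic_continuous_eq_zero[OF conn j])
    show "continuous_on UNIV (\<lambda>y. v0 y - m)" by (intro continuous_intros v0c)
    show "(LINT y|\<mu>. v0 y - m) = 0"
      using continuous_integrable[OF v0c] prob_space by (simp add: m_def)
  qed (simp add: per)
  from this[of 0] this[of x] show False using v0_0 v0_x by simp
qed

lemma integral_nat_multiple:
  fixes u :: "'a \<Rightarrow> 'b::{real_normed_field, banach, second_countable_topology}"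
  assumes conn: "connected (UNIV :: 'a set)" and j: "j > 0" and u: "continuous_on UNIV u"
  shows "(LINT g|\<mu>. u (nat_multiple j g)) = (LINT g|\<mu>. u g)"
proof -
  have m: "(\<lambda>g. nat_multiple j g) \<in> \<mu> \<rightarrow>\<^sub>M borel"
    by (intro continuous_measurable continuous_intros)
  have ut: "(\<lambda>x. u (t + x)) \<in> borel_measurable borel" for t
    by (intro borel_measurable_continuous_onI continuous_translate u)
  have um: "(\<lambda>x. u (nat_multiple j x)) \<in> borel_measurable \<mu>"
    using ut[of 0] by (intro measurable_compose[OF m]) simp
  let ?\<nu> = "distr \<mu> borel (\<lambda>g. nat_multiple j g)"
  have d: "(LINT x|?\<nu>. u (t + x)) = (LINT g|\<mu>. u (t + nat_multiple j g))" for t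
    by (rule integral_distr[OF m ut])
  have "(LINT x|?\<nu>. u x) = (LINT x|\<mu>. u x)"
  proof (rule integral_eq_if_invariant[OF prob_space_distr[OF m] _ u])
    fix t :: 'a
    obtain s where s: "nat_multiple j s = t" using nat_multiple_surj[OF conn j] by blast
    show "(LINT x|?\<nu>. u (t + x)) = (LINT x|?\<nu>. u x)"
      using integral_translate[OF um, of s] d[of t] d[of 0] by (simp add: nat_multiple_distrib s)
  qed simp
  then show ?thesis using d[of 0] by simp
qed

end

section \<open>Powers of the symbol on the unit circle\<close>

text \<open>The sum of the squared moduli of the coefficients; by Parseval's identity it is the mean of
  \<open>\<bar>p\<bar>^2\<close> over the unit circle.\<close>

definition coeff_sq :: "complex poly \<Rightarrow> real" where
  "coeff_sq p = (\<Sum>i\<le>degree p. (cmod (coeff p i))\<^sup>2)"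

lemma coeff_sq_nonneg: "coeff_sq p \<ge> 0"
  by (simp add: coeff_sq_def sum_nonneg)

lemma has_integral_cis:
  "((\<lambda>t. cis (of_int k * t)) has_integral (if k = 0 then 2 * pi else 0)) {0..2 * pi}"
proof (cases "k = 0")
  case True
  then show ?thesis
    using has_integral_const_real[of "1 :: complex" 0 "2 * pi"] by (simp add: scaleR_conv_of_real)
next
  case False
  define F where "F t = cis (of_int k * t) / (\<i> * of_int k)" for t :: real
  have der: "(F has_vector_derivative cis (of_int k * t)) (at t within {0..2 * pi})" for t
  proof -
    have "((\<lambda>t. exp (\<i> * of_int k * complex_of_real t) / (\<i> * of_int k)) has_vector_derivative
        exp (\<i> * of_int k * complex_of_real t)) (at t within {0..2 * pi})"
      by (rule has_vector_derivative_real_field)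
        (use False in \<open>auto intro!: derivative_eq_intros simp: field_simps\<close>)
    then show ?thesis by (simp add: F_def[abs_def] cis_conv_exp mult.assoc)
  qed
  have "((\<lambda>t. cis (of_int k * t)) has_integral (F (2 * pi) - F 0)) {0..2 * pi}"
    by (rule fundamental_theorem_of_calculus[OF _ der]) simp
  moreover have "cis (of_int k * (2 * pi)) = 1"
    using cis_multiple_2pi[of "of_int k"] by (simp add: mult_ac)
  ultimately show ?thesis using False by (simp add: F_def)
qed

lemma parseval_poly:
  "((\<lambda>t. (cmod (poly p (cis t)))\<^sup>2) has_integral (2 * pi * coeff_sq p)) {0..2 * pi}"
proof -
  let ?d = "degree p"
  have "((\<lambda>t. \<Sum>i\<le>?d. \<Sum>l\<le>?d. coeff p i * cnj (coeff p l) * cis (of_int (int i - int l) * t)) has_integral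
      (\<Sum>i\<le>?d. \<Sum>l\<le>?d. coeff p i * cnj (coeff p l) * (if int i - int l = 0 then 2 * pi else 0))) {0..2 * pi}"
    by (intro has_integral_sum has_integral_mult_right has_integral_cis) auto
  also have "(\<lambda>t. \<Sum>i\<le>?d. \<Sum>l\<le>?d. coeff p i * cnj (coeff p l) * cis (of_int (int i - int l) * t))
    = (\<lambda>t. complex_of_real ((cmod (poly p (cis t)))\<^sup>2))"
  proof
    fix t
    have "complex_of_real ((cmod (poly p (cis t)))\<^sup>2) = poly p (cis t) * cnj (poly p (cis t))"
      by (rule complex_norm_square)
    also have "\<dots> = (\<Sum>i\<le>?d. coeff p i * cis t ^ i) * (\<Sum>l\<le>?d. cnj (coeff p l) * cis (- t) ^ l)"
      by (simp add: poly_altdef cis_cnj)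
    also have "\<dots> = (\<Sum>i\<le>?d. \<Sum>l\<le>?d. coeff p i * cnj (coeff p l) * cis (of_int (int i - int l) * t))"
    proof -
      have e: "cis (of_int (int i - int l) * t) = cis (real i * t) * cis (real l * - t)" for i l
        by (simp add: cis_mult algebra_simps)
      show ?thesis
        unfolding sum_product Complex.DeMoivre e by (simp only: mult_ac)
    qed
    finally show "(\<Sum>i\<le>?d. \<Sum>l\<le>?d. coeff p i * cnj (coeff p l) * cis (of_int (int i - int l) * t))
      = complex_of_real ((cmod (poly p (cis t)))\<^sup>2)" by simp
  qed
  also have "(\<Sum>i\<le>?d. \<Sum>l\<le>?d. coeff p i * cnj (coeff p l) * (if int i - int l = 0 then 2 * pi else 0))
    = complex_of_real (2 * pi * coeff_sq p)"
  proof -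
    have "(\<Sum>l\<le>?d. coeff p i * cnj (coeff p l) * (if int i - int l = 0 then 2 * pi else 0))
      = complex_of_real (2 * pi) * complex_of_real ((cmod (coeff p i))\<^sup>2)" if "i \<le> ?d" for i
    proof -
      have "(\<Sum>l\<le>?d. coeff p i * cnj (coeff p l) * (if int i - int l = 0 then 2 * pi else 0))
        = (\<Sum>l\<le>?d. if i = l then coeff p i * cnj (coeff p l) * (2 * pi) else 0)"
        by (intro sum.cong) auto
      also have "\<dots> = coeff p i * cnj (coeff p i) * (2 * pi)" using that by simp
      finally show ?thesis by (simp only: complex_norm_square mult.commute)
    qed
    then show ?thesis by (simp add: coeff_sq_def sum_distrib_left)
  qed
  finally have "((\<lambda>t. Re (complex_of_real ((cmod (poly p (cis t)))\<^sup>2))) has_integral Re (complex_of_real (2 * pi * coeff_sq p))) {0..2 * pi}"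
    by (rule has_integral_Re)
  then show ?thesis by simp
qed

lemma sin_half_ge:
  assumes "0 < e" "e \<le> 1" "e \<le> t" "t \<le> 2 * pi - e"
  shows "e / 4 \<le> sin (t / 2)"
proof -
  obtain z where z: "0 < z" "z < e / 2" "sin (e / 2) - sin 0 = (e / 2 - 0) * cos z"
    using MVT2[of 0 "e / 2" sin cos] assms(1) by (auto intro: DERIV_sin)
  have "cos (pi / 3) \<le> cos z"
    using z assms pi_gt3 by (intro cos_monotone_0_pi_le) auto
  then have "1 / 2 \<le> cos z" by (simp add: cos_60)
  then have "(e / 2) * (1 / 2) \<le> (e / 2) * cos z"
    using assms(1) by (intro mult_left_mono) auto
  also have "\<dots> = sin (e / 2)" using z(3) by simp
  finally have "(e / 2) * (1 / 2) \<le> sin (e / 2)" .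
  moreover have "sin (e / 2) \<le> sin (t / 2)"
  proof (cases "t / 2 \<le> pi / 2")
    case True
    then show ?thesis using assms by (intro sin_monotone_2pi_le) auto
  next
    case False
    then have "sin (e / 2) \<le> sin (pi - t / 2)" using assms by (intro sin_monotone_2pi_le) auto
    then show ?thesis by simp
  qed
  ultimately show ?thesis by simp
qed

text \<open>A \<open>2 \<pi>\<close>-periodic function that concentrates around the multiples of \<open>2 \<pi>\<close> as \<open>K\<close> grows. The
  sum of two rescaled copies dominates the squared modulus of a power of the symbol.\<close>

definition bump :: "nat \<Rightarrow> real \<Rightarrow> real" where
  "bump K t = (1 - sin (t / 2) ^ 4) ^ K"

lemma bump_bounds: "0 \<le> bump K t" "bump K t \<le> 1"
proof -
  have "sin (t / 2) ^ 4 = (\<bar>sin (t / 2)\<bar>) ^ 4" by (simp add: power_even_abs)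
  then have "sin (t / 2) ^ 4 \<le> 1" using abs_sin_le_one by (simp only: power_le_one abs_ge_zero)
  then show "0 \<le> bump K t" "bump K t \<le> 1"
    by (auto simp: bump_def intro!: zero_le_power power_le_one)
qed

lemma continuous_on_bump: "continuous_on S (\<lambda>t. bump K (c * t))"
  unfolding bump_def by (intro continuous_intros) auto

lemma bump_integrable: "(\<lambda>t. bump K (c * t)) integrable_on {a..b}"
  by (rule integrable_continuous_interval[OF continuous_on_bump])

lemma bump_periodic: "bump K (2 * pi + t) = bump K t"
proof -
  have "sin ((2 * pi + t) / 2) = - sin (t / 2)" by (simp add: add_divide_distrib add.commute)
  then show ?thesis by (simp add: bump_def)
qed

lemma integral_bump_multiple:
  "integral {0..2 * pi * real m} (bump K) = real m * integral {0..2 * pi} (bump K)"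
proof (induction m)
  case (Suc m)
  have bi: "bump K integrable_on {a..b}" for a b using bump_integrable[of K 1] by simp
  have per: "bump K (2 * pi * real k + t) = bump K t" for k t
  proof (induction k)
    case (Suc k)
    have "bump K (2 * pi * real (Suc k) + t) = bump K (2 * pi + (2 * pi * real k + t))"
      by (simp add: algebra_simps)
    then show ?case using Suc bump_periodic by simp
  qed simp
  have "integral {0 + 2 * pi * real m..2 * pi + 2 * pi * real m} (bump K) = integral {0..2 * pi} (bump K)"
    unfolding integral_shift_Icc_real[symmetric] by (simp add: comp_def per)
  moreover have "integral {0..2 * pi * real m} (bump K) + integral {2 * pi * real m..2 * pi * real (Suc m)} (bump K)
      = integral {0..2 * pi * real (Suc m)} (bump K)"
    by (rule Henstock_Kurzweil_Integration.integral_combine[OF _ _ bi]) (auto simp: algebra_simps)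
  ultimately show ?case using Suc by (simp add: algebra_simps)
qed simp

lemma integral_bump_scaled:
  assumes "m > 0"
  shows "integral {0..2 * pi} (\<lambda>t. bump K (real m * t)) = integral {0..2 * pi} (bump K)"
proof -
  have "(\<lambda>x. x / real m) ` {0..2 * pi * real m} = {0..2 * pi}"
    using assms by (auto simp: image_iff field_simps intro!: bexI[of _ "real m * _"])
  then show ?thesis
    using integral_stretch_real[of "real m" 0 "2 * pi * real m" "bump K"] assms
    by (simp add: integral_bump_multiple)
qed

text \<open>Outside the distance \<open>e\<close> of the peaks the function is at most \<open>exp (- K (e / 4)^4)\<close>; the choice
  \<open>e = K^(-1/8)\<close> is far from optimal, but any negative power of \<open>K\<close> is enough.\<close>

lemma integral_bump_le:
  assumes "K > 0"
  shows "integral {0..2 * pi} (bump K) \<le> (2 + 512 * pi) * real K powr (- 1 / 8)"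
proof -
  define e where "e = real K powr (- 1 / 8)"
  have e: "0 < e" "e \<le> 1" using assms powr_mono[of "- 1 / 8" 0 "real K"] by (simp_all add: e_def)
  have e8: "real K * e ^ 8 = 1"
  proof -
    have "e ^ 8 = e powr real (8 :: nat)" by (rule powr_realpow[OF e(1), symmetric])
    also have "\<dots> = real K powr (- 1)" unfolding e_def powr_powr by simp
    also have "\<dots> = inverse (real K)" using assms by (simp add: powr_minus)
    finally show ?thesis using assms by simp
  qed
  have bi: "bump K integrable_on {a..b}" for a b using bump_integrable[of K 1] by simp
  have pi: "e \<le> 2 * pi - e" using e pi_gt3 by simp
  have le1: "integral {a..b} (bump K) \<le> (b - a) * 1" if "a \<le> b" for a b
  proof -
    have "integral {a..b} (bump K) \<le> integral {a..b} (\<lambda>_. 1)"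
      by (intro integral_le bi bump_bounds) auto
    then show ?thesis using that by simp
  qed
  have mid: "bump K t \<le> 256 * e" if t: "t \<in> {e..2 * pi - e}" for t
  proof -
    have s: "(e / 4) ^ 4 \<le> sin (t / 2) ^ 4"
      using sin_half_ge[OF e, of t] t e by (intro power_mono) auto
    define y where "y = real K * (e / 4) ^ 4"
    have y: "y = 1 / (256 * e ^ 4)"
    proof -
      have "256 * e ^ 4 * y = real K * e ^ 8" by (simp add: y_def power_divide)
      then show ?thesis using e8 e by (simp add: field_simps)
    qed
    have y0: "y > 0" using y e by simp
    have "bump K t \<le> (1 - (e / 4) ^ 4) ^ K"
      unfolding bump_def using s bump_bounds(1)[of 1 t] by (intro power_mono) (auto simp: bump_def)
    also have "\<dots> \<le> exp (- ((e / 4) ^ 4)) ^ K"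
    proof (rule power_mono)
      show "1 - (e / 4) ^ 4 \<le> exp (- ((e / 4) ^ 4))" using exp_ge_add_one_self[of "- ((e / 4) ^ 4)"] by simp
      have "(e / 4) ^ 4 \<le> 1" using e by (intro power_le_one) auto
      then show "0 \<le> 1 - (e / 4) ^ 4" by simp
    qed
    also have "\<dots> = exp (- y)" by (simp add: exp_of_nat_mult[symmetric] y_def)
    also have "\<dots> \<le> 1 / y"
    proof -
      have "y \<le> exp y" using exp_ge_add_one_self[of y] by linarith
      then show ?thesis using y0 by (simp add: exp_minus field_simps)
    qed
    also have "\<dots> = 256 * e ^ 4" using y by simp
    also have "\<dots> \<le> 256 * e" using e power_decreasing[of 1 4 e] by simp
    finally show ?thesis .
  qed
  have "integral {e..2 * pi - e} (bump K) \<le> integral {e..2 * pi - e} (\<lambda>_. 256 * e)"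
    by (intro integral_le bi mid) auto
  also have "\<dots> = (2 * pi - 2 * e) * (256 * e)" using pi by simp
  also have "\<dots> \<le> 2 * pi * (256 * e)" using e by (intro mult_right_mono) auto
  finally have m: "integral {e..2 * pi - e} (bump K) \<le> 512 * pi * e" by simp
  have "integral {0..2 * pi} (bump K) = integral {0..e} (bump K) + integral {e..2 * pi - e} (bump K) + integral {2 * pi - e..2 * pi} (bump K)"
    using Henstock_Kurzweil_Integration.integral_combine[OF _ _ bi, of 0 e "2 * pi"] Henstock_Kurzweil_Integration.integral_combine[OF _ _ bi, of e "2 * pi - e" "2 * pi"] e pi by simp
  also have "\<dots> \<le> e + 512 * pi * e + e"
    using le1[of 0 e] le1[of "2 * pi - e" "2 * pi"] m e by simp
  also have "\<dots> = (2 + 512 * pi) * e" by (simp add: algebra_simps)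
  finally show ?thesis by (simp add: e_def)
qed

text \<open>The polynomial \<open>X^(n + 1) * (X + X^(-1) - X^n - X^(-n))\<close>; the power of \<open>X\<close> removes the negative
  exponents and has modulus 1 on the unit circle.\<close>

definition cos_poly :: "nat \<Rightarrow> complex poly" where
  "cos_poly n = monom 1 (n + 2) + monom 1 n - monom 1 (2 * n + 1) - monom 1 1"

text \<open>The polynomial \<open>X^(2 n + 2) * (1 - t^2 / 16)\<close> for the Laurent polynomial
  \<open>t = X + X^(-1) - X^n - X^(-n)\<close>.\<close>

definition symbol :: "nat \<Rightarrow> complex poly" where
  "symbol n = monom 1 (2 * n + 2) - smult (1 / 16) (cos_poly n * cos_poly n)"

lemma poly_cos_poly:
  "poly (cos_poly n) (cis t) = cis (real (n + 1) * t) * complex_of_real (2 * cos t - 2 * cos (real n * t))"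
proof -
  have two: "complex_of_real (2 * cos s) = cis s + cis (- s)" for s
    by (simp add: complex_eq_iff)
  have eq: "complex_of_real (2 * cos t - 2 * cos (real n * t)) = cis t + cis (- t) - (cis (real n * t) + cis (- (real n * t)))"
    using two[of t] two[of "real n * t"] by (simp only: of_real_diff)
  show ?thesis unfolding eq
    by (simp add: cos_poly_def poly_monom Complex.DeMoivre distrib_left right_diff_distrib cis_mult algebra_simps)
qed

lemma cmod_symbol:
  "cmod (poly (symbol n) (cis t)) = 1 - (sin ((real n + 1) * t / 2))\<^sup>2 * (sin ((real n - 1) * t / 2))\<^sup>2"
proof -
  define x where "x = sin ((real n + 1) * t / 2)"
  define y where "y = sin ((real n - 1) * t / 2)"
  have "cos t - cos (real n * t) = 2 * x * y"
    unfolding x_def y_def cos_diff_cos by (simp add: algebra_simps)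
  then have c: "2 * cos t - 2 * cos (real n * t) = 4 * x * y" by simp
  have "poly (symbol n) (cis t) = cis (real (n + 1) * t) * cis (real (n + 1) * t) * complex_of_real (1 - x\<^sup>2 * y\<^sup>2)"
  proof -
    have "cis t ^ (2 * n + 2) = cis (real (n + 1) * t) * cis (real (n + 1) * t)"
      by (simp add: Complex.DeMoivre cis_mult algebra_simps)
    then show ?thesis
      by (simp add: symbol_def poly_monom poly_cos_poly c del: of_real_mult)
         (simp add: algebra_simps power2_eq_square)
  qed
  then have "cmod (poly (symbol n) (cis t)) = \<bar>1 - x\<^sup>2 * y\<^sup>2\<bar>"
    by (simp only: norm_mult norm_cis norm_of_real mult_1)
  moreover have "x\<^sup>2 \<le> 1" "y\<^sup>2 \<le> 1" by (simp_all add: x_def y_def abs_square_le_1)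
  then have "x\<^sup>2 * y\<^sup>2 \<le> 1" by (intro mult_le_one) auto
  ultimately show ?thesis by (simp add: x_def y_def)
qed

lemma coeff_sq_symbol_power_le:
  assumes n: "n \<noteq> 1" and k: "k > 0"
  shows "coeff_sq (symbol n ^ k) \<le> 4 * (1 + 256 * pi) * real k powr (- 1 / 8)"
proof -
  \<comment> \<open>Natural subtraction would give 0 for \<open>n = 0\<close>, but \<open>b\<close> must be positive.\<close>
  define b where "b = nat \<bar>int n - 1\<bar>"
  have b: "b > 0" using n by (simp add: b_def)
  have b': "real b = \<bar>real n - 1\<bar>" by (simp add: b_def)
  let ?K = "2 * k"
  have le: "(cmod (poly (symbol n ^ k) (cis t)))\<^sup>2 \<le> bump ?K (real (n + 1) * t) + bump ?K (real b * t)" for t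
  proof -
    define x where "x = (sin ((real n + 1) * t / 2))\<^sup>2"
    define y where "y = (sin ((real n - 1) * t / 2))\<^sup>2"
    have xy: "0 \<le> x" "x \<le> 1" "0 \<le> y" "y \<le> 1" by (simp_all add: x_def y_def abs_square_le_1)
    have "(cmod (poly (symbol n ^ k) (cis t)))\<^sup>2 = (1 - x * y) ^ ?K"
      by (simp add: cmod_symbol norm_power power_mult[symmetric] mult.commute x_def y_def)
    moreover have "bump ?K (real (n + 1) * t) = (1 - x\<^sup>2) ^ ?K"
      by (simp add: bump_def x_def power_mult[symmetric] add.commute)
    moreover have "bump ?K (real b * t) = (1 - y\<^sup>2) ^ ?K"
    proof -
      have "sin (real b * t / 2) ^ 4 = sin ((real n - 1) * t / 2) ^ 4"
      proof -
        have "real b * t / 2 = (real n - 1) * t / 2 \<or> real b * t / 2 = - ((real n - 1) * t / 2)"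
          by (auto simp: b' abs_if left_diff_distrib)
        then show ?thesis by (auto simp: sin_minus)
      qed
      then show ?thesis by (simp add: bump_def y_def power_mult[symmetric])
    qed
    \<comment> \<open>One of \<open>x\<^sup>2\<close> and \<open>y\<^sup>2\<close> is at most \<open>x y\<close>; this separates the zeros of the two sines.\<close>
    moreover have "(1 - x * y) ^ ?K \<le> (1 - x\<^sup>2) ^ ?K + (1 - y\<^sup>2) ^ ?K"
    proof (cases "x \<le> y")
      case True
      then have "1 - x * y \<le> 1 - x\<^sup>2" using xy by (simp add: power2_eq_square mult_left_mono)
      then have "(1 - x * y) ^ ?K \<le> (1 - x\<^sup>2) ^ ?K" using xy by (intro power_mono) (auto simp: mult_le_one)
      moreover have "0 \<le> (1 - y\<^sup>2) ^ ?K" using xy by (intro zero_le_power) (simp add: power_le_one)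
      ultimately show ?thesis by linarith
    next
      case False
      then have "1 - x * y \<le> 1 - y\<^sup>2" using xy by (simp add: power2_eq_square mult_right_mono)
      then have "(1 - x * y) ^ ?K \<le> (1 - y\<^sup>2) ^ ?K" using xy by (intro power_mono) (auto simp: mult_le_one)
      moreover have "0 \<le> (1 - x\<^sup>2) ^ ?K" using xy by (intro zero_le_power) (simp add: power_le_one)
      ultimately show ?thesis by linarith
    qed
    ultimately show ?thesis by simp
  qed
  have "2 * pi * coeff_sq (symbol n ^ k) = integral {0..2 * pi} (\<lambda>t. (cmod (poly (symbol n ^ k) (cis t)))\<^sup>2)"
    by (rule integral_unique[OF parseval_poly, symmetric])
  also have "\<dots> \<le> integral {0..2 * pi} (\<lambda>t. bump ?K (real (n + 1) * t) + bump ?K (real b * t))"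
    by (intro integral_le integrable_add bump_integrable le has_integral_integrable[OF parseval_poly])
  also have "\<dots> = 2 * integral {0..2 * pi} (bump ?K)"
    using b by (simp add: integral_add[OF bump_integrable bump_integrable] integral_bump_scaled del: of_nat_add of_nat_Suc)
  also have "\<dots> \<le> 2 * ((2 + 512 * pi) * real ?K powr (- 1 / 8))"
    using integral_bump_le[of ?K] k by simp
  also have "\<dots> \<le> 2 * ((2 + 512 * pi) * real k powr (- 1 / 8))"
    using k by (intro mult_left_mono powr_mono2') auto
  also have "\<dots> = 4 * (1 + 256 * pi) * real k powr (- 1 / 8)" by (simp add: algebra_simps)
  finally have "2 * pi * coeff_sq (symbol n ^ k) \<le> 4 * (1 + 256 * pi) * real k powr (- 1 / 8)" .
  moreover have "1 * coeff_sq (symbol n ^ k) \<le> 2 * pi * coeff_sq (symbol n ^ k)"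
    using pi_gt3 by (intro mult_right_mono coeff_sq_nonneg) simp
  ultimately show ?thesis by simp
qed

lemma summable_coeff_sq_symbol:
  assumes n: "n \<noteq> 1"
  shows "summable (\<lambda>k. (real k + 1)\<^sup>2 * coeff_sq (symbol n ^ k) ^ 32)"
proof (rule summable_comparison_test_ev)
  define C where "C = 4 * (1 + 256 * pi)"
  show "\<forall>\<^sub>F k in sequentially. norm ((real k + 1)\<^sup>2 * coeff_sq (symbol n ^ k) ^ 32) \<le> 4 * C ^ 32 * (1 / real k ^ 2)"
  proof (rule eventually_sequentiallyI[of 1])
    fix k :: nat assume "1 \<le> k"
    then have k: "k > 0" by simp
    have "coeff_sq (symbol n ^ k) ^ 32 \<le> (C * real k powr (- 1 / 8)) ^ 32"
      using coeff_sq_symbol_power_le[OF n k] by (intro power_mono) (auto simp: C_def coeff_sq_nonneg)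
    also have "(real k powr (- 1 / 8)) ^ 32 = 1 / real k ^ 4"
    proof -
      have "(real k powr (- 1 / 8)) ^ 32 = (real k powr (- 1 / 8)) powr real (32 :: nat)"
        using k by (intro powr_realpow[symmetric]) simp
      also have "\<dots> = real k powr (- real (4 :: nat))" unfolding powr_powr by simp
      also have "\<dots> = inverse (real k powr real (4 :: nat))" by (rule powr_minus)
      also have "real k powr real (4 :: nat) = real k ^ 4" using k by (intro powr_realpow) simp
      finally show ?thesis by (simp add: inverse_eq_divide)
    qed
    then have "(C * real k powr (- 1 / 8)) ^ 32 = C ^ 32 * (1 / real k ^ 4)"
      by (simp only: power_mult_distrib)
    finally have 1: "coeff_sq (symbol n ^ k) ^ 32 \<le> C ^ 32 * (1 / real k ^ 4)" .
    have "(real k + 1)\<^sup>2 \<le> (2 * real k)\<^sup>2" using k by (intro power_mono) auto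
    then have "(real k + 1)\<^sup>2 \<le> 4 * real k ^ 2" by (simp add: power_mult_distrib)
    from mult_mono[OF this 1] have "(real k + 1)\<^sup>2 * coeff_sq (symbol n ^ k) ^ 32 \<le> (4 * real k ^ 2) * (C ^ 32 * (1 / real k ^ 4))"
      using coeff_sq_nonneg by simp
    also have "\<dots> = 4 * C ^ 32 * (1 / real k ^ 2)"
      using k by (simp add: field_simps power2_eq_square eval_nat_numeral)
    finally show "norm ((real k + 1)\<^sup>2 * coeff_sq (symbol n ^ k) ^ 32) \<le> 4 * C ^ 32 * (1 / real k ^ 2)"
      by (simp add: coeff_sq_nonneg)
  qed
  show "summable (\<lambda>k. 4 * C ^ 32 * (1 / real k ^ 2))"
    using inverse_power_summable[of 2, where 'a = real] by (intro summable_mult) (simp add: inverse_eq_divide power_divide)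
qed

section \<open>Polynomials in a translation\<close>

text \<open>The action of a polynomial on functions, where \<open>X\<close> acts as \<open>u \<mapsto> u (g + x)\<close>.\<close>

definition poly_act :: "complex poly \<Rightarrow> 'a::comm_monoid_add \<Rightarrow> ('a \<Rightarrow> complex) \<Rightarrow> 'a \<Rightarrow> complex" where
  "poly_act p g u x = (\<Sum>i\<le>degree p. coeff p i * u (nat_multiple i g + x))"

lemma poly_act_bound:
  assumes "degree p \<le> d"
  shows "poly_act p g u x = (\<Sum>i\<le>d. coeff p i * u (nat_multiple i g + x))"
  unfolding poly_act_def
  by (rule sum.mono_neutral_left) (use assms in \<open>auto simp: coeff_eq_0\<close>)

lemma poly_act_0 [simp]: "poly_act 0 g u x = 0"
  by (simp add: poly_act_def)

lemma poly_act_pCons: "poly_act (pCons a p) g u x = a * u x + poly_act p g u (g + x)"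
proof -
  have "poly_act (pCons a p) g u x = (\<Sum>i\<le>Suc (degree p). coeff (pCons a p) i * u (nat_multiple i g + x))"
    by (rule poly_act_bound) (rule degree_pCons_le)
  also have "\<dots> = a * u x + (\<Sum>i\<le>degree p. coeff p i * u (nat_multiple i g + (g + x)))"
    by (simp add: sum.atMost_Suc_shift ac_simps del: sum.atMost_Suc)
  finally show ?thesis by (simp add: poly_act_def)
qed

lemma poly_act_add: "poly_act (p + q) g u x = poly_act p g u x + poly_act q g u x"
  using poly_act_bound[of p "max (degree p) (degree q)" g u x] poly_act_bound[of q "max (degree p) (degree q)" g u x]
    poly_act_bound[of "p + q" "max (degree p) (degree q)" g u x] degree_add_le_max[of p q]
  by (simp add: sum.distrib distrib_right)

lemma poly_act_smult: "poly_act (smult c p) g u x = c * poly_act p g u x"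
  using poly_act_bound[of "smult c p" "degree p" g u x]
  by (simp add: poly_act_def sum_distrib_left mult.assoc degree_smult_le)

lemma poly_act_diff: "poly_act (p - q) g u x = poly_act p g u x - poly_act q g u x"
  using poly_act_add[of p "smult (- 1) q" g u x] poly_act_smult[of "- 1" q g u x] by simp

lemma poly_act_monom: "poly_act (monom 1 m) g u x = u (nat_multiple m g + x)"
proof (induction m arbitrary: x)
  case 0
  show ?case by (simp add: monom_0 poly_act_pCons)
next
  case (Suc m)
  then show ?case by (simp add: monom_Suc poly_act_pCons ac_simps)
qed

lemma poly_act_mult: "poly_act (p * q) g u x = poly_act p g (poly_act q g u) x"
proof (induction p arbitrary: x)
  case (pCons a p)
  then show ?case
    by (simp add: mult_pCons_left poly_act_add poly_act_smult poly_act_pCons)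
qed simp

text \<open>The operator on whose range \<open>L\<close> vanishes by condition (ii). In that condition \<open>n\<close> is an integer, but only
  its absolute value matters.\<close>

definition cos_difference :: "nat \<Rightarrow> 'a::ab_group_add \<Rightarrow> ('a \<Rightarrow> complex) \<Rightarrow> 'a \<Rightarrow> complex" where
  "cos_difference n g v x = v (g + x) + v (- g + x) - v (nat_multiple n g + x) - v (- nat_multiple n g + x)"

text \<open>The operator \<open>1 - T^2 / 16\<close> for \<open>T = cos_difference n g\<close>. Up to a translation it is the action of
  \<open>symbol n\<close>.\<close>

definition contraction :: "nat \<Rightarrow> 'a::ab_group_add \<Rightarrow> ('a \<Rightarrow> complex) \<Rightarrow> 'a \<Rightarrow> complex" where
  "contraction n g v x = v x - 1 / 16 * cos_difference n g (cos_difference n g v) x"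

lemma cos_difference_translate: "cos_difference n g (\<lambda>x. v (h + x)) x = cos_difference n g v (h + x)"
  by (simp add: cos_difference_def algebra_simps)

lemma contraction_translate: "contraction n g (\<lambda>x. v (h + x)) x = contraction n g v (h + x)"
proof -
  have "cos_difference n g (\<lambda>x. v (h + x)) = (\<lambda>x. cos_difference n g v (h + x))"
    by (rule ext) (rule cos_difference_translate)
  then show ?thesis by (simp only: contraction_def cos_difference_translate)
qed

lemma poly_act_cos_poly: "poly_act (cos_poly n) g v x = cos_difference n g v (nat_multiple (n + 1) g + x)"
  by (simp add: cos_poly_def poly_act_diff poly_act_add poly_act_monom cos_difference_def nat_multiple_add mult_2 mult_2_right algebra_simps)

lemma poly_act_symbol: "poly_act (symbol n) g v x = contraction n g v (nat_multiple (2 * n + 2) g + x)"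
proof -
  let ?h = "nat_multiple (n + 1) g"
  have "poly_act (cos_poly n * cos_poly n) g v x = cos_difference n g (cos_difference n g v) (?h + (?h + x))"
  proof -
    have "poly_act (cos_poly n) g v = (\<lambda>x. cos_difference n g v (?h + x))"
      by (rule ext) (rule poly_act_cos_poly)
    then show ?thesis by (simp only: poly_act_mult poly_act_cos_poly cos_difference_translate)
  qed
  also have "?h + (?h + x) = nat_multiple (2 * n + 2) g + x"
  proof -
    have "2 * n + 2 = (n + 1) + (n + 1)" by simp
    then show ?thesis by (simp only: nat_multiple_add add.assoc)
  qed
  finally show ?thesis
    by (simp add: symbol_def poly_act_diff poly_act_smult poly_act_monom contraction_def)
qed

lemma poly_act_symbol_power:
  "poly_act (symbol n ^ k) g v x = (contraction n g ^^ k) v (nat_multiple (k * (2 * n + 2)) g + x)"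
proof (induction k arbitrary: x)
  case 0
  show ?case using poly_act_monom[of 0 g v x] by (simp add: monom_0 one_pCons)
next
  case (Suc k)
  let ?M = "2 * n + 2"
  have IH: "poly_act (symbol n ^ k) g v = (\<lambda>x. (contraction n g ^^ k) v (nat_multiple (k * ?M) g + x))"
    using Suc by (simp add: fun_eq_iff)
  have "poly_act (symbol n ^ Suc k) g v x
    = contraction n g (\<lambda>x. (contraction n g ^^ k) v (nat_multiple (k * ?M) g + x)) (nat_multiple ?M g + x)"
    by (simp only: power_Suc poly_act_mult poly_act_symbol IH)
  also have "\<dots> = contraction n g ((contraction n g ^^ k) v) (nat_multiple (k * ?M) g + (nat_multiple ?M g + x))"
    by (rule contraction_translate)
  also have "nat_multiple (k * ?M) g + (nat_multiple ?M g + x) = nat_multiple (Suc k * ?M) g + x"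
    using nat_multiple_add[of ?M "k * ?M" g] by (simp only: mult_Suc ac_simps)
  finally show ?case by simp
qed

lemma cos_difference_commute:
  "cos_difference n g (cos_difference n h v) = cos_difference n h (cos_difference n g v)"
  by (simp add: fun_eq_iff cos_difference_def ac_simps) (simp add: algebra_simps)

lemma cos_difference_contraction:
  "cos_difference n g (contraction n h v) = contraction n h (cos_difference n g v)"
proof -
  have "cos_difference n g (contraction n h v) x = cos_difference n g v x
    - 1 / 16 * cos_difference n g (cos_difference n h (cos_difference n h v)) x" for x
    by (simp add: cos_difference_def[of n g] contraction_def algebra_simps)
  then show ?thesis
    by (simp add: fun_eq_iff cos_difference_commute[of n g h] contraction_def)
qed

lemma contraction_commute: "contraction n g (contraction n h v) = contraction n h (contraction n g v)"
proof -
  have "contraction n h (contraction n g v) x = contraction n h v x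
    - 1 / 16 * contraction n h (cos_difference n g (cos_difference n g v)) x" for x
    by (simp add: cos_difference_def[of n h] contraction_def algebra_simps)
  then show ?thesis
    by (simp add: fun_eq_iff contraction_def[of n g "contraction n h v"] cos_difference_contraction)
qed

lemma funpow_commute_comp:
  assumes "\<And>v. A (B v) = B (A v)"
  shows "(A ^^ k) ((B ^^ k) v) = ((\<lambda>v. A (B v)) ^^ k) v"
proof (induction k)
  case (Suc k)
  have c: "(A ^^ k) (B w) = B ((A ^^ k) w)" for w k
    by (induction k) (simp_all add: assms)
  show ?case using Suc by (simp add: c)
qed simp

lemma foldr_contraction_commute:
  "contraction n g (foldr (contraction n) gs v) = foldr (contraction n) gs (contraction n g v)"
  by (induction gs) (simp_all add: contraction_commute[of n g])

lemma foldr_contraction_funpow: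
  "foldr (\<lambda>g. contraction n g ^^ k) gs v = (foldr (contraction n) gs ^^ k) v"
proof (induction gs)
  case Nil
  have "((\<lambda>v. v) ^^ k) v = v" by (induction k) simp_all
  then show ?case by (simp add: id_def)
next
  case (Cons g gs)
  then show ?case
    using funpow_commute_comp[of "contraction n g" "foldr (contraction n) gs" k v, OF foldr_contraction_commute]
    by (simp add: comp_def)
qed

section \<open>The mean energy of a polynomial in a random translation\<close>

context haar_measure begin

lemma L2_cos_difference: "v \<in> L2 \<Longrightarrow> cos_difference n g v \<in> L2"
  unfolding cos_difference_def[abs_def] by (intro L2_add L2_diff L2_translate)

lemma L2_contraction: "v \<in> L2 \<Longrightarrow> contraction n g v \<in> L2"
  unfolding contraction_def[abs_def] by (intro L2_diff L2_cmult L2_cos_difference)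

lemma L2_contraction_power: "v \<in> L2 \<Longrightarrow> (contraction n g ^^ k) v \<in> L2"
  by (induction k) (simp_all add: L2_contraction)

lemma L2_foldr_contraction: "v \<in> L2 \<Longrightarrow> foldr (\<lambda>g. contraction n g ^^ k) gs v \<in> L2"
  by (induction gs) (simp_all add: L2_contraction_power)

lemma L2_foldr_contraction1: "v \<in> L2 \<Longrightarrow> foldr (contraction n) gs v \<in> L2"
  by (induction gs) (simp_all add: L2_contraction)

lemma integral_cos_difference:
  assumes "v \<in> L2"
  shows "(LINT x|\<mu>. cos_difference n g v x) = 0"
proof -
  note i = L2_integrable[OF L2_translate[OF assms]]
  note t = integral_translate[OF L2_measurable[OF assms]]
  show ?thesis
    unfolding cos_difference_def
    by (simp only: Bochner_Integration.integral_diff Bochner_Integration.integral_add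
        Bochner_Integration.integrable_diff Bochner_Integration.integrable_add i t) simp
qed

lemma integral_contraction:
  assumes "v \<in> L2"
  shows "(LINT x|\<mu>. contraction n g v x) = (LINT x|\<mu>. v x)"
proof -
  have "cos_difference n g (cos_difference n g v) \<in> L2" by (intro L2_cos_difference assms)
  from L2_integrable[OF this] L2_integrable[OF assms] show ?thesis
    by (simp add: contraction_def[abs_def] integral_cos_difference[OF L2_cos_difference[OF assms]])
qed

lemma integral_contraction_power:
  "v \<in> L2 \<Longrightarrow> (LINT x|\<mu>. (contraction n g ^^ k) v x) = (LINT x|\<mu>. v x)"
  by (induction k) (simp_all add: integral_contraction L2_contraction_power)

lemma integral_foldr_contraction:
  "v \<in> L2 \<Longrightarrow> (LINT x|\<mu>. foldr (\<lambda>g. contraction n g ^^ k) gs v x) = (LINT x|\<mu>. v x)"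
  by (induction gs) (simp_all add: integral_contraction_power L2_foldr_contraction)

lemma of_real_l2sq: "complex_of_real (l2sq u) = (LINT x|\<mu>. u x * cnj (u x))"
  unfolding l2sq_def integral_complex_of_real[symmetric] by (simp only: complex_norm_square)

text \<open>The inner products between distinct multiples of a translation vanish on average, because a
  multiple of a Haar distributed element is again Haar distributed.\<close>

lemma translate_inner:
  assumes conn: "connected (UNIV :: 'a set)" and u: "u \<in> L2" and mean: "(LINT x|\<mu>. u x) = 0"
  defines "I \<equiv> \<lambda>i l g. LINT x|\<mu>. u (nat_multiple i g + x) * cnj (u (nat_multiple l g + x))"
  shows "continuous_on UNIV (I i l)"
    and "(LINT g|\<mu>. I i l g) = (if i = l then complex_of_real (l2sq u) else 0)"
proof -
  define \<phi> where "\<phi> t = (LINT x|\<mu>. u (t + x) * cnj (u x))" for t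
  have cu: "(\<lambda>x. cnj (u x)) \<in> L2" by (rule L2_cnj[OF u])
  have \<phi>c: "continuous_on UNIV \<phi>"
    unfolding \<phi>_def by (rule continuous_correlation_L2[OF u cu])
  have \<phi>m: "(LINT t|\<mu>. \<phi> t) = 0"
    unfolding \<phi>_def using mean_correlation[OF u cu] mean by simp
  have \<phi>jc: "continuous_on UNIV (\<lambda>g. \<phi> (nat_multiple j g))" for j
    by (rule continuous_on_compose2[OF \<phi>c]) (auto intro!: continuous_intros)
  have I_ge: "I i l g = \<phi> (nat_multiple (i - l) g)" if "l \<le> i" for i l g
  proof -
    have "(\<lambda>x. u (nat_multiple (i - l) g + x) * cnj (u x)) \<in> borel_measurable \<mu>"
      using L2_integrable_mult(1)[OF L2_translate[OF u] cu] by simp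
    from integral_translate[OF this, of "nat_multiple l g"]
    have "\<phi> (nat_multiple (i - l) g) = (LINT x|\<mu>. u (nat_multiple (i - l) g + (nat_multiple l g + x)) * cnj (u (nat_multiple l g + x)))"
      by (simp add: \<phi>_def)
    moreover have "nat_multiple (i - l) g + (nat_multiple l g + x) = nat_multiple i g + x" for x
      using nat_multiple_add[of "i - l" l g] that by (simp add: ac_simps)
    ultimately show ?thesis by (simp add: I_def)
  qed
  have I_cnj: "I i l g = cnj (I l i g)" for i l g
    unfolding I_def Bochner_Integration.integral_cnj[symmetric] by (simp add: mult.commute)
  show "continuous_on UNIV (I i l)"
  proof (cases "l \<le> i")
    case True
    have "I i l = (\<lambda>g. \<phi> (nat_multiple (i - l) g))" by (rule ext) (rule I_ge[OF True])
    then show ?thesis by (simp only: \<phi>jc)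
  next
    case False
    then have "i \<le> l" by simp
    have "I i l = (\<lambda>g. cnj (\<phi> (nat_multiple (l - i) g)))"
      by (rule ext) (simp only: I_cnj[of i l] I_ge[OF \<open>i \<le> l\<close>])
    moreover have "continuous_on UNIV (\<lambda>g. cnj (\<phi> (nat_multiple (l - i) g)))"
      by (intro continuous_intros \<phi>jc)
    ultimately show ?thesis by (simp only:)
  qed
  have zero: "(LINT g|\<mu>. I i l g) = 0" if "l < i" for i l
    using integral_nat_multiple[OF conn _ \<phi>c, of "i - l"] that \<phi>m by (simp add: I_ge)
  show "(LINT g|\<mu>. I i l g) = (if i = l then complex_of_real (l2sq u) else 0)"
  proof (cases i l rule: linorder_cases)
    case less
    have "(LINT g|\<mu>. I i l g) = cnj (LINT g|\<mu>. I l i g)"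
      unfolding Bochner_Integration.integral_cnj[symmetric] by (simp only: I_cnj[of i l])
    then show ?thesis using zero[OF less] less by simp
  next
    case equal
    then have "I i l g = complex_of_real (l2sq u)" for g
      using I_ge[of l i g] by (simp add: \<phi>_def of_real_l2sq)
    then show ?thesis using equal prob_space by simp
  next
    case greater
    then show ?thesis using zero by simp
  qed
qed

lemma mean_energy_poly_act:
  assumes conn: "connected (UNIV :: 'a set)" and u: "u \<in> L2" and mean: "(LINT x|\<mu>. u x) = 0"
  shows "continuous_on UNIV (\<lambda>g. l2sq (poly_act p g u))"
    and "(LINT g|\<mu>. l2sq (poly_act p g u)) = coeff_sq p * l2sq u"
proof -
  define I where "I i l g = (LINT x|\<mu>. u (nat_multiple i g + x) * cnj (u (nat_multiple l g + x)))" for i l g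
  note I = translate_inner[OF conn u mean, folded I_def]
  let ?d = "degree p"
  have eq: "complex_of_real (l2sq (poly_act p g u)) = (\<Sum>i\<le>?d. \<Sum>l\<le>?d. coeff p i * cnj (coeff p l) * I i l g)" for g
  proof -
    have i: "integrable \<mu> (\<lambda>x. u (nat_multiple i g + x) * cnj (u (nat_multiple l g + x)))" for i l
      by (intro L2_integrable_mult(1) L2_translate u L2_cnj)
    have "complex_of_real (l2sq (poly_act p g u)) = (LINT x|\<mu>. (\<Sum>i\<le>?d. \<Sum>l\<le>?d.
        coeff p i * cnj (coeff p l) * (u (nat_multiple i g + x) * cnj (u (nat_multiple l g + x)))))"
      unfolding of_real_l2sq poly_act_def by (simp add: sum_product mult_ac)
    also have "\<dots> = (\<Sum>i\<le>?d. \<Sum>l\<le>?d. coeff p i * cnj (coeff p l) * I i l g)"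
      using i by (simp add: I_def)
    finally show ?thesis .
  qed
  have cont: "continuous_on UNIV (\<lambda>g. complex_of_real (l2sq (poly_act p g u)))"
    unfolding eq by (intro continuous_intros I(1))
  have "continuous_on UNIV (\<lambda>g. Re (complex_of_real (l2sq (poly_act p g u))))"
    by (intro continuous_intros cont)
  then show "continuous_on UNIV (\<lambda>g. l2sq (poly_act p g u))" by simp
  have "complex_of_real (LINT g|\<mu>. l2sq (poly_act p g u)) = (LINT g|\<mu>. (\<Sum>i\<le>?d. \<Sum>l\<le>?d. coeff p i * cnj (coeff p l) * I i l g))"
    unfolding integral_complex_of_real[symmetric] eq ..
  also have "\<dots> = (\<Sum>i\<le>?d. \<Sum>l\<le>?d. coeff p i * cnj (coeff p l) * (LINT g|\<mu>. I i l g))"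
    using continuous_integrable[OF I(1)] by simp
  also have "\<dots> = (\<Sum>i\<le>?d. \<Sum>l\<le>?d. if i = l then coeff p i * cnj (coeff p l) * l2sq u else 0)"
    by (intro sum.cong refl) (simp add: I(2))
  also have "\<dots> = (\<Sum>i\<le>?d. coeff p i * cnj (coeff p i) * l2sq u)" by simp
  also have "\<dots> = complex_of_real (coeff_sq p * l2sq u)"
    by (simp add: coeff_sq_def complex_norm_square[symmetric] sum_distrib_right)
  finally show "(LINT g|\<mu>. l2sq (poly_act p g u)) = coeff_sq p * l2sq u"
    using of_real_eq_iff by blast
qed

text \<open>The powers of the contraction differ from the action of the powers of its symbol by a translation
  only, which does not change the norm.\<close>

lemma mean_energy_contraction:
  assumes conn: "connected (UNIV :: 'a set)" and u: "u \<in> L2" and mean: "(LINT x|\<mu>. u x) = 0"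
  shows "continuous_on UNIV (\<lambda>g. l2sq ((contraction n g ^^ k) u))"
    and "(LINT g|\<mu>. l2sq ((contraction n g ^^ k) u)) = coeff_sq (symbol n ^ k) * l2sq u"
proof -
  have "l2sq (poly_act (symbol n ^ k) g u) = l2sq ((contraction n g ^^ k) u)" for g
  proof -
    have "poly_act (symbol n ^ k) g u = (\<lambda>x. (contraction n g ^^ k) u (nat_multiple (k * (2 * n + 2)) g + x))"
      by (simp only: fun_eq_iff poly_act_symbol_power simp_thms)
    then show ?thesis using l2sq_translate[OF L2_contraction_power[OF u]] by simp
  qed
  with mean_energy_poly_act[OF assms, of "symbol n ^ k"]
  show "continuous_on UNIV (\<lambda>g. l2sq ((contraction n g ^^ k) u))"
    and "(LINT g|\<mu>. l2sq ((contraction n g ^^ k) u)) = coeff_sq (symbol n ^ k) * l2sq u"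
    by simp_all
qed

text \<open>Some value of an integrable function is finite: by Tonelli's theorem for sums, the mean over \<open>g\<close> of
  the sum in the conclusion is the sum in the last assumption.\<close>

lemma exists_translation:
  fixes W :: "nat \<Rightarrow> real"
  assumes conn: "connected (UNIV :: 'a set)"
    and u: "\<And>k. u k \<in> L2" "\<And>k. (LINT x|\<mu>. u k x) = 0" and W: "\<And>k. W k \<ge> 0"
    and sm: "summable (\<lambda>k. W k * coeff_sq (symbol n ^ k) * l2sq (u k))"
  shows "\<exists>g. summable (\<lambda>k. W k * l2sq ((contraction n g ^^ k) (u k)))"
proof -
  define e where "e k g = W k * l2sq ((contraction n g ^^ k) (u k))" for k g
  have e0: "e k g \<ge> 0" for k g using W l2sq_nonneg by (simp add: e_def)
  have ec: "continuous_on UNIV (e k)" for k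
    unfolding e_def by (intro continuous_intros mean_energy_contraction(1) conn u)
  have [measurable]: "e k \<in> borel_measurable \<mu>" for k by (rule continuous_measurable[OF ec])
  have "(\<integral>\<^sup>+g. (\<Sum>k. ennreal (e k g)) \<partial>\<mu>) = (\<Sum>k. \<integral>\<^sup>+g. ennreal (e k g) \<partial>\<mu>)"
    by (rule nn_integral_suminf) measurable
  also have "\<dots> = (\<Sum>k. ennreal (W k * coeff_sq (symbol n ^ k) * l2sq (u k)))"
  proof (rule suminf_cong)
    fix k
    have "(\<integral>\<^sup>+g. ennreal (e k g) \<partial>\<mu>) = ennreal (LINT g|\<mu>. e k g)"
      using e0 continuous_integrable[OF ec] by (intro nn_integral_eq_integral) auto
    then show "(\<integral>\<^sup>+g. ennreal (e k g) \<partial>\<mu>) = ennreal (W k * coeff_sq (symbol n ^ k) * l2sq (u k))"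
      by (simp add: e_def mean_energy_contraction(2)[OF conn u] mult.assoc)
  qed
  also have "\<dots> \<noteq> \<infinity>"
    unfolding infinity_ennreal_def
    by (intro ennreal_suminf_neq_top sm mult_nonneg_nonneg W coeff_sq_nonneg l2sq_nonneg)
  finally have "AE g in \<mu>. (\<Sum>k. ennreal (e k g)) \<noteq> \<infinity>"
    by (intro nn_integral_PInf_AE) auto
  then have "\<exists>g. (\<Sum>k. ennreal (e k g)) \<noteq> \<infinity>"
    using AE_const by (metis (mono_tags, lifting) AE_mp AE_I2)
  then obtain g where "(\<Sum>k. ennreal (e k g)) \<noteq> top" by auto
  from summable_suminf_not_top[OF e0 this] show ?thesis unfolding e_def by blast
qed

text \<open>Induction on \<open>m\<close>: every choice of an element removes one factor from the assumption on \<open>W\<close>.\<close>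

lemma exists_translations:
  fixes W :: "nat \<Rightarrow> real"
  assumes conn: "connected (UNIV :: 'a set)"
    and f: "f \<in> L2" "(LINT x|\<mu>. f x) = 0" and W: "\<And>k. W k \<ge> 0"
    and sm: "summable (\<lambda>k. W k * coeff_sq (symbol n ^ k) ^ m)"
  shows "\<exists>gs. summable (\<lambda>k. W k * l2sq (foldr (\<lambda>g. contraction n g ^^ k) gs f))"
  using W sm
proof (induction m arbitrary: W)
  case 0
  then have "summable (\<lambda>k. W k * l2sq f)" by (intro summable_mult2) simp
  then show ?case by (intro exI[of _ "[]"]) (simp add: id_def)
next
  case (Suc m)
  let ?W = "\<lambda>k. W k * coeff_sq (symbol n ^ k)"
  have W0: "?W k \<ge> 0" for k by (intro mult_nonneg_nonneg Suc.prems(1) coeff_sq_nonneg)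
  have sm: "summable (\<lambda>k. ?W k * coeff_sq (symbol n ^ k) ^ m)"
    using Suc.prems(2) by (simp add: mult.assoc)
  from Suc.IH[OF W0 sm]
  obtain gs where gs: "summable (\<lambda>k. ?W k * l2sq (foldr (\<lambda>g. contraction n g ^^ k) gs f))" ..
  have mean: "(LINT x|\<mu>. foldr (\<lambda>g. contraction n g ^^ k) gs f x) = 0" for k
    using integral_foldr_contraction[OF f(1)] f(2) by simp
  obtain g where "summable (\<lambda>k. W k * l2sq ((contraction n g ^^ k) (foldr (\<lambda>g. contraction n g ^^ k) gs f)))"
    using exists_translation[OF conn L2_foldr_contraction[OF f(1)] mean Suc.prems(1) gs] ..
  then show ?case by (intro exI[of _ "g # gs"]) simp
qed

section \<open>Solving the difference equation\<close>

lemma AE_sums_cos_difference: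
  assumes "AE x in \<mu>. (\<lambda>k. u k x) sums h x"
  shows "AE x in \<mu>. (\<lambda>k. cos_difference n g (u k) x) sums cos_difference n g h x"
  using AE_translate[OF assms, of g] AE_translate[OF assms, of "- g"]
    AE_translate[OF assms, of "nat_multiple n g"] AE_translate[OF assms, of "- nat_multiple n g"]
proof eventually_elim
  case (elim x)
  then show ?case unfolding cos_difference_def by (intro sums_add sums_diff)
qed

lemma AE_sums_contraction:
  assumes "AE x in \<mu>. (\<lambda>k. u k x) sums h x"
  shows "AE x in \<mu>. (\<lambda>k. contraction n g (u k) x) sums contraction n g h x"
  using assms AE_sums_cos_difference[OF AE_sums_cos_difference[OF assms, of n g], of n g]
proof eventually_elim
  case (elim x)
  then show ?case unfolding contraction_def by (intro sums_diff sums_mult)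
qed

lemma AE_sums_foldr_contraction:
  assumes "AE x in \<mu>. (\<lambda>k. u k x) sums h x"
  shows "AE x in \<mu>. (\<lambda>k. foldr (contraction n) gs (u k) x) sums foldr (contraction n) gs h x"
  using assms by (induction gs) (simp_all add: AE_sums_contraction)

text \<open>A series in \<open>L^2\<close> whose squared norms are summable with the weights \<open>(k + 1)^2\<close> converges almost
  everywhere: by the Cauchy-Schwarz inequality the squared modulus of its sum at \<open>x\<close> is at most a multiple of
  \<open>\<Sum>k. (k + 1)^2 * \<bar>u k x\<bar>^2\<close>.\<close>

lemma weighted_series_L2:
  assumes u: "\<And>k. u k \<in> L2" and sm: "summable (\<lambda>k. (real k + 1)\<^sup>2 * l2sq (u k))"
  obtains h where "h \<in> L2" "AE x in \<mu>. (\<lambda>k. u k x) sums h x"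
proof -
  have [measurable]: "u k \<in> borel_measurable \<mu>" for k by (rule L2_measurable[OF u])
  define a where "a k x = (real k + 1)\<^sup>2 * (cmod (u k x))\<^sup>2" for k x
  define S where "S x = (\<Sum>k. ennreal (a k x))" for x
  have a0: "a k x \<ge> 0" for k x by (simp add: a_def)
  have [measurable]: "a k \<in> borel_measurable \<mu>" for k unfolding a_def by measurable
  have [measurable]: "S \<in> borel_measurable \<mu>" unfolding S_def by measurable
  have "(\<integral>\<^sup>+x. S x \<partial>\<mu>) = (\<Sum>k. \<integral>\<^sup>+x. ennreal (a k x) \<partial>\<mu>)"
    unfolding S_def by (rule nn_integral_suminf) measurable
  also have "\<dots> = (\<Sum>k. ennreal ((real k + 1)\<^sup>2 * l2sq (u k)))"
  proof (rule suminf_cong)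
    fix k
    have "(\<integral>\<^sup>+x. ennreal (a k x) \<partial>\<mu>) = ennreal (LINT x|\<mu>. a k x)"
      using a0 L2_integrable_sq[OF u] by (intro nn_integral_eq_integral) (auto simp: a_def)
    then show "(\<integral>\<^sup>+x. ennreal (a k x) \<partial>\<mu>) = ennreal ((real k + 1)\<^sup>2 * l2sq (u k))"
      by (simp add: a_def l2sq_def)
  qed
  also have "\<dots> \<noteq> \<infinity>"
    unfolding infinity_ennreal_def
    by (intro ennreal_suminf_neq_top sm mult_nonneg_nonneg zero_le_power2 l2sq_nonneg)
  finally have Sfin: "(\<integral>\<^sup>+x. S x \<partial>\<mu>) \<noteq> \<infinity>" .
  then have "AE x in \<mu>. S x \<noteq> \<infinity>" by (intro nn_integral_PInf_AE) auto
  then have good: "AE x in \<mu>. summable (\<lambda>k. a k x)"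
    by eventually_elim (auto simp: S_def intro!: summable_suminf_not_top a0)
  have sq: "summable (\<lambda>k. 1 / (real k + 1)\<^sup>2)"
    using inverse_power_summable[of 2, where 'a = real, THEN summable_ignore_initial_segment, of 1]
    by (simp add: inverse_eq_divide power_divide add.commute)
  define C where "C = (\<Sum>k. 1 / (real k + 1)\<^sup>2)"
  have C0: "C \<ge> 0" unfolding C_def using sq by (intro suminf_nonneg) auto
  define h where "h x = (\<Sum>k. u k x)" for x
  have hm [measurable]: "h \<in> borel_measurable \<mu>" unfolding h_def by measurable
  have sums: "(\<lambda>k. u k x) sums h x" if "summable (\<lambda>k. a k x)" for x
  proof -
    have "cmod (u k x) \<le> a k x + 1 / (real k + 1)\<^sup>2" for k
    proof -
      have "2 * ((real k + 1) * cmod (u k x)) * (1 / (real k + 1)) \<le> ((real k + 1) * cmod (u k x))\<^sup>2 + (1 / (real k + 1))\<^sup>2"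
        by (rule sum_squares_bound)
      then have "2 * cmod (u k x) \<le> a k x + 1 / (real k + 1)\<^sup>2"
        by (simp add: a_def power_mult_distrib power_divide)
      then show ?thesis using norm_ge_zero[of "u k x"] by linarith
    qed
    then have "summable (\<lambda>k. u k x)"
      by (intro summable_comparison_test[OF _ summable_add[OF that sq]]) auto
    then show ?thesis unfolding h_def by (rule summable_sums)
  qed
  have bound: "ennreal ((cmod (h x))\<^sup>2) \<le> ennreal C * S x" if sa: "summable (\<lambda>k. a k x)" for x
  proof -
    have "(cmod (\<Sum>k<N. u k x))\<^sup>2 \<le> C * (\<Sum>k. a k x)" for N
    proof -
      have "cmod (\<Sum>k<N. u k x) \<le> (\<Sum>k<N. (1 / (real k + 1)) * ((real k + 1) * cmod (u k x)))"
        using norm_sum[of "\<lambda>k. u k x" "{..<N}"] by (simp add: add_pos_nonneg less_imp_neq[symmetric])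
      then have "(cmod (\<Sum>k<N. u k x))\<^sup>2 \<le> (\<Sum>k<N. (1 / (real k + 1)) * ((real k + 1) * cmod (u k x)))\<^sup>2"
        by (intro power_mono) auto
      also have "\<dots> \<le> (\<Sum>k<N. (1 / (real k + 1))\<^sup>2) * (\<Sum>k<N. ((real k + 1) * cmod (u k x))\<^sup>2)"
        by (rule Cauchy_Schwarz_ineq_sum)
      also have "\<dots> = (\<Sum>k<N. 1 / (real k + 1)\<^sup>2) * (\<Sum>k<N. a k x)"
        by (simp add: a_def power_divide power_mult_distrib)
      also have "\<dots> \<le> C * (\<Sum>k. a k x)"
        unfolding C_def using sq sa a0 by (intro mult_mono sum_le_suminf suminf_nonneg sum_nonneg) auto
      finally show ?thesis .
    qed
    moreover have "(\<lambda>N. (cmod (\<Sum>k<N. u k x))\<^sup>2) \<longlonglongrightarrow> (cmod (h x))\<^sup>2"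
      using sums[OF sa] unfolding sums_def by (intro tendsto_intros)
    ultimately have "(cmod (h x))\<^sup>2 \<le> C * (\<Sum>k. a k x)"
      by (intro LIMSEQ_le_const2) auto
    then have "ennreal ((cmod (h x))\<^sup>2) \<le> ennreal (C * (\<Sum>k. a k x))" by (rule ennreal_leI)
    also have "\<dots> = ennreal C * ennreal (\<Sum>k. a k x)" by (rule ennreal_mult') (rule C0)
    also have "ennreal (\<Sum>k. a k x) = S x"
      unfolding S_def using suminf_ennreal2[OF a0 sa] by simp
    finally show ?thesis .
  qed
  have "(\<integral>\<^sup>+x. ennreal ((cmod (h x))\<^sup>2) \<partial>\<mu>) \<le> (\<integral>\<^sup>+x. ennreal C * S x \<partial>\<mu>)"
    using good by (intro nn_integral_mono_AE) (auto elim!: eventually_mono bound)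
  also have "\<dots> = ennreal C * (\<integral>\<^sup>+x. S x \<partial>\<mu>)" by (rule nn_integral_cmult) measurable
  also have "\<dots> < \<infinity>" using Sfin by (simp add: ennreal_mult_less_top less_top)
  finally have "integrable \<mu> (\<lambda>x. (cmod (h x))\<^sup>2)"
    by (intro integrableI_bounded) auto
  then have "h \<in> L2" by (simp add: square_integrable_def)
  moreover have "AE x in \<mu>. (\<lambda>k. u k x) sums h x" using good by eventually_elim (rule sums)
  ultimately show ?thesis by (rule that)
qed

text \<open>The function \<open>h\<close> is the sum of the orbit of \<open>f\<close> under the product of contractions.\<close>

lemma difference_equation:
  assumes conn: "connected (UNIV :: 'a set)" and n: "n \<noteq> 1"
    and f: "f \<in> L2" "(LINT x|\<mu>. f x) = 0"
  obtains gs h where "h \<in> L2" "AE x in \<mu>. f x = h x - foldr (contraction n) gs h x"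
proof -
  obtain gs where gs: "summable (\<lambda>k. (real k + 1)\<^sup>2 * l2sq (foldr (\<lambda>g. contraction n g ^^ k) gs f))"
    using exists_translations[OF conn f zero_le_power2 summable_coeff_sq_symbol[OF n]] by (rule exE)
  define u where "u k = foldr (\<lambda>g. contraction n g ^^ k) gs f" for k
  have u_Suc: "u (Suc k) = foldr (contraction n) gs (u k)" for k
    unfolding u_def foldr_contraction_funpow by simp
  have u_0: "u 0 = f" unfolding u_def by (induction gs) simp_all
  have "u k \<in> L2" for k unfolding u_def by (rule L2_foldr_contraction[OF f(1)])
  then obtain h where h: "h \<in> L2" "AE x in \<mu>. (\<lambda>k. u k x) sums h x"
    using weighted_series_L2[of u] gs unfolding u_def by blast
  from h(2) AE_sums_foldr_contraction[OF h(2), of n gs]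
  have "AE x in \<mu>. f x = h x - foldr (contraction n) gs h x"
  proof eventually_elim
    case (elim x)
    have "(\<lambda>k. u (Suc k) x) sums foldr (contraction n) gs h x" using elim(2) by (simp add: u_Suc)
    then have "(\<lambda>k. u k x) sums (foldr (contraction n) gs h x + u 0 x)"
      by (simp only: sums_Suc_iff[of "\<lambda>k. u k x"])
    from sums_unique2[OF this elim(1)] show ?case by (simp add: u_0 algebra_simps)
  qed
  with h(1) show ?thesis by (rule that)
qed

end

section \<open>Linear forms\<close>

context haar_measure begin

lemma L2_class_cong: "AE x in \<mu>. f x = h x \<Longrightarrow> L2_class \<mu> f = L2_class \<mu> h"
  unfolding L2_class_def by (auto elim!: eventually_elim2)

lemma linear_form_add:
  "L2_linear_form \<mu> L \<Longrightarrow> f \<in> L2 \<Longrightarrow> h \<in> L2 \<Longrightarrow>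
    L (L2_class \<mu> (\<lambda>x. f x + h x)) = L (L2_class \<mu> f) + L (L2_class \<mu> h)"
  and linear_form_scale:
  "L2_linear_form \<mu> L \<Longrightarrow> f \<in> L2 \<Longrightarrow> L (L2_class \<mu> (\<lambda>x. c * f x)) = c * L (L2_class \<mu> f)"
  by (simp_all add: L2_linear_form_def)

lemma linear_form_diff:
  assumes "L2_linear_form \<mu> L" "f \<in> L2" "h \<in> L2"
  shows "L (L2_class \<mu> (\<lambda>x. f x - h x)) = L (L2_class \<mu> f) - L (L2_class \<mu> h)"
  using linear_form_add[OF assms(1,2) L2_cmult[OF assms(3), of "- 1"]] linear_form_scale[OF assms(1,3), of "- 1"]
  by simp

lemma linear_form_contraction:
  assumes L: "L2_linear_form \<mu> L"
    and inv: "\<And>g f. f \<in> L2 \<Longrightarrow> L (L2_class \<mu> (cos_difference n g f)) = 0"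
    and v: "v \<in> L2"
  shows "L (L2_class \<mu> (foldr (contraction n) gs v)) = L (L2_class \<mu> v)"
proof (induction gs)
  case (Cons g gs)
  have "L (L2_class \<mu> (contraction n g w)) = L (L2_class \<mu> w)" if w: "w \<in> L2" for w
  proof -
    have "L (L2_class \<mu> (contraction n g w))
      = L (L2_class \<mu> w) - 1 / 16 * L (L2_class \<mu> (cos_difference n g (cos_difference n g w)))"
      unfolding contraction_def[abs_def]
      by (simp only: linear_form_diff[OF L w] linear_form_scale[OF L] L2_cmult L2_cos_difference w)
    then show ?thesis using inv[OF L2_cos_difference[OF w]] by simp
  qed
  from this[OF L2_foldr_contraction1[OF v]] Cons show ?case by simp
qed simp

text \<open>Subtracting the mean of \<open>f\<close> reduces the claim to a function of mean 0. For \<open>n = 1\<close> the assumption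
  \<open>inv\<close> would hold for every linear form, since then \<open>cos_difference\<close> vanishes identically.\<close>

lemma linear_form_eq_integral:
  assumes conn: "connected (UNIV :: 'a set)" and L: "L2_linear_form \<mu> L" and n: "n \<noteq> 1"
    and inv: "\<And>g f. f \<in> L2 \<Longrightarrow> L (L2_class \<mu> (cos_difference n g f)) = 0"
    and f: "f \<in> L2"
  shows "L (L2_class \<mu> f) = L (L2_class \<mu> (\<lambda>_. 1)) * (LINT x|\<mu>. f x)"
proof -
  define m where "m = (LINT x|\<mu>. f x)"
  define f0 where "f0 x = f x - m * 1" for x
  have mL: "(\<lambda>x. m * 1) \<in> L2" by (rule L2_const)
  have f0: "f0 \<in> L2" unfolding f0_def by (intro L2_diff f mL)
  have "(LINT x|\<mu>. f0 x) = 0"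
    using L2_integrable[OF f] prob_space by (simp add: f0_def m_def)
  from difference_equation[OF conn n f0 this]
  obtain gs h where h: "h \<in> L2" "AE x in \<mu>. f0 x = h x - foldr (contraction n) gs h x" .
  have "L (L2_class \<mu> f0) = L (L2_class \<mu> (\<lambda>x. h x - foldr (contraction n) gs h x))"
    by (simp only: L2_class_cong[OF h(2)])
  also have "\<dots> = 0"
    using linear_form_diff[OF L h(1) L2_foldr_contraction1[OF h(1)]] linear_form_contraction[OF L inv h(1)] by simp
  finally have "L (L2_class \<mu> f) - L (L2_class \<mu> (\<lambda>x. m * 1)) = 0"
    using linear_form_diff[OF L f mL] by (simp add: f0_def[abs_def])
  then show ?thesis using linear_form_scale[OF L L2_const[of 1], of m] by (simp add: m_def mult.commute)
qed

lemma L2_dirac_conv: "f \<in> L2 \<Longrightarrow> dirac_conv g f \<in> L2"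
  unfolding dirac_conv_def by (rule L2_translate)

lemma integral_dirac_conv: "f \<in> L2 \<Longrightarrow> (LINT x|\<mu>. dirac_conv g f x) = (LINT x|\<mu>. f x)"
  unfolding dirac_conv_def by (rule integral_translate[OF L2_measurable])

lemma int_multiple_pair:
  "(\<lambda>x. dirac_conv (int_multiple n g) f x + dirac_conv (int_multiple (- n) g) f x)
    = (\<lambda>x. f (nat_multiple (nat \<bar>n\<bar>) g + x) + f (- nat_multiple (nat \<bar>n\<bar>) g + x))"
  by (cases n "0 :: int" rule: linorder_cases) (simp_all add: int_multiple_eq dirac_conv_def fun_eq_iff add.commute)

lemma invariant_imp_pair_invariant:
  assumes L: "L2_linear_form \<mu> L"
    and inv: "\<forall>g. \<forall>f\<in>L2. L (L2_class \<mu> (dirac_conv g f)) = L (L2_class \<mu> f)"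
    and f: "f \<in> L2"
  shows "L (L2_class \<mu> (\<lambda>x. dirac_conv g f x + dirac_conv h f x)) = 2 * L (L2_class \<mu> f)"
  using linear_form_add[OF L L2_dirac_conv[OF f, of g] L2_dirac_conv[OF f, of h]] inv f by simp

lemma pair_invariant_imp_cos_difference:
  assumes L: "L2_linear_form \<mu> L"
    and inv: "\<forall>g. \<forall>f\<in>L2. L (L2_class \<mu> (\<lambda>x. dirac_conv g f x + dirac_conv (- g) f x)) =
      L (L2_class \<mu> (\<lambda>x. dirac_conv (int_multiple n g) f x + dirac_conv (int_multiple (- n) g) f x))"
    and f: "f \<in> L2"
  shows "L (L2_class \<mu> (cos_difference (nat \<bar>n\<bar>) g f)) = 0"
proof -
  let ?h = "nat_multiple (nat \<bar>n\<bar>) g"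
  have eq: "L (L2_class \<mu> (\<lambda>x. f (g + x) + f (- g + x))) = L (L2_class \<mu> (\<lambda>x. f (?h + x) + f (- ?h + x)))"
  proof -
    have "(\<lambda>x. dirac_conv g f x + dirac_conv (- g) f x) = (\<lambda>x. f (g + x) + f (- g + x))"
      by (simp add: fun_eq_iff dirac_conv_def add.commute)
    then show ?thesis using inv f unfolding int_multiple_pair by metis
  qed
  have "cos_difference (nat \<bar>n\<bar>) g f = (\<lambda>x. (f (g + x) + f (- g + x)) - (f (?h + x) + f (- ?h + x)))"
    by (simp add: fun_eq_iff cos_difference_def)
  then show ?thesis
    by (simp only: linear_form_diff[OF L L2_add L2_add] L2_translate f eq diff_self)
qed

end

theorem theorem7p3:
  fixes \<mu> :: "'a::{topological_ab_group_add, t2_space} measure"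
  assumes "compact (UNIV :: 'a set)"
    and "connected (UNIV :: 'a set)"
    and "normalised_haar \<mu>"
  shows "(\<forall>L. L2_linear_form \<mu> L \<longrightarrow>
      ((\<forall>g. \<forall>f\<in>square_integrable \<mu>.
           L (L2_class \<mu> (dirac_conv g f)) = L (L2_class \<mu> f))
       \<longleftrightarrow>
       (\<exists>n::int. n \<notin> {-1, 1} \<and>
          (\<forall>g. \<forall>f\<in>square_integrable \<mu>.
             L (L2_class \<mu> (\<lambda>x. dirac_conv g f x + dirac_conv (- g) f x)) =
             L (L2_class \<mu> (\<lambda>x. dirac_conv (int_multiple n g) f x
                                + dirac_conv (int_multiple (- n) g) f x)))))
      \<and>
      ((\<exists>n::int. n \<notin> {-1, 1} \<and>
          (\<forall>g. \<forall>f\<in>square_integrable \<mu>.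
             L (L2_class \<mu> (\<lambda>x. dirac_conv g f x + dirac_conv (- g) f x)) =
             L (L2_class \<mu> (\<lambda>x. dirac_conv (int_multiple n g) f x
                                + dirac_conv (int_multiple (- n) g) f x))))
       \<longleftrightarrow>
       (\<exists>c. \<forall>f\<in>square_integrable \<mu>. L (L2_class \<mu> f) = c * (LINT x|\<mu>. f x))))
    \<and> (\<forall>\<nu>. normalised_haar \<nu> \<longrightarrow> \<nu> = \<mu>)"
proof (intro conjI allI impI)
  interpret haar_measure \<mu> by unfold_locales (use assms in auto)
  fix L assume L: "L2_linear_form \<mu> L"
  let ?i = "\<forall>g. \<forall>f\<in>L2. L (L2_class \<mu> (dirac_conv g f)) = L (L2_class \<mu> f)"
  let ?P = "\<lambda>n. \<forall>g. \<forall>f\<in>L2. L (L2_class \<mu> (\<lambda>x. dirac_conv g f x + dirac_conv (- g) f x)) =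
    L (L2_class \<mu> (\<lambda>x. dirac_conv (int_multiple n g) f x + dirac_conv (int_multiple (- n) g) f x))"
  let ?ii = "\<exists>n::int. n \<notin> {-1, 1} \<and> ?P n"
  let ?iii = "\<exists>c. \<forall>f\<in>L2. L (L2_class \<mu> f) = c * (LINT x|\<mu>. f x)"
  have i_ii: ?ii if ?i
  proof (intro exI[of _ 0] conjI allI ballI)
    show "(0 :: int) \<notin> {-1, 1}" by simp
  qed (simp only: invariant_imp_pair_invariant[OF L that])
  have ii_iii: ?iii if ?ii
  proof -
    from that obtain n where n: "n \<notin> {-1, 1}" "?P n" by blast
    then have "nat \<bar>n\<bar> \<noteq> 1" by auto
    from linear_form_eq_integral[OF assms(2) L this pair_invariant_imp_cos_difference[OF L n(2)]]
    show ?iii by blast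
  qed
  have iii_i: ?i if ?iii
    using that by (auto simp: L2_dirac_conv integral_dirac_conv)
  show "?i \<longleftrightarrow> ?ii" using i_ii ii_iii iii_i by argo
  show "?ii \<longleftrightarrow> ?iii" using i_ii ii_iii iii_i by argo
next
  interpret haar_measure \<mu> by unfold_locales (use assms in auto)
  fix \<nu> :: "'a measure" assume "normalised_haar \<nu>"
  then show "\<nu> = \<mu>" by (rule haar_unique)
qed

end
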